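(* Let $B$ be a unital algebra over a field $K$, let $(A,E)$ be any $B$-valued noncommutative probability space, let $x,y\in A$ be free random variables, and assume that $E(x)$ and $E(y)$ are invertible elements of $B$. Then the unsymmetrized T-transforms of the distribution series satisfy $$\widetilde T_{\widetilde\Phi_{xy}}=\big(\widetilde T_{\widetilde\Phi_x}\circ(\widetilde T_{\widetilde\Phi_y}\,I\,\widetilde T_{\widetilde\Phi_y}^{-1})\big)\,\widetilde T_{\widetilde\Phi_y},$$ where products and the inverse are with respect to the formal product in $\mathrm{Mul}[[B]]$ and $\circ$ is formal composition.
   Context: Noncommutative probability. For a unital algebra $B$ over a field $K$, a $B$-valued noncommutative probability space is a pair $(A,E)$ where $A$ is a unital algebra containing $B$ as a unital subalgebra and $E:A\to B$ is a linear idempotent map restricting to the identity on $B$ and satisfying $E(b_1ab_2)=b_1E(a)b_2$ for $b_1,b_2\in B$, $a\in A$. Elements of $A$ are called random variables. Subalgebras $A_i\subseteq A$ ($i\in I$), each containing $B$, are free if $E(a_1a_2\cdots a_n)=0$ whenever $n\in\mathbf N$, $a_j\in A_{i_j}\cap\ker E$ and $i_1\ne i_2,\ldots,i_{n-1}\ne i_n$. Random variables $a_i$ are free if the algebras generated by $\{a_i\}\cup B$ are free. Formal multilinear function series. $\mathrm{Mul}[[B]]$ is the set of sequences $\alpha=(\alpha_0,\alpha_1,\alpha_2,\ldots)$ with $\alpha_0\in B$ and, for $n\ge1$, $\alpha_n:B\times\cdots\times B\to B$ an $n$-multilinear ($K$-multilinear) map. Addition is termwise. The formal product is $(\alpha\beta)_n(b_1,\ldots,b_n)=\sum_{k=0}^n\alpha_k(b_1,\ldots,b_k)\beta_{n-k}(b_{k+1},\ldots,b_n)$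 (with $(\alpha\beta)_0=\alpha_0\beta_0$). If $\beta_0=0$, the formal composition $\alpha\circ\beta$ is given by $(\alpha\circ\beta)_0=\alpha_0$ and, for $n\ge1$, $$(\alpha\circ\beta)_n(b_1,\ldots,b_n)=\sum_{k=1}^n\ \sum_{\substack{p_1,\ldots,p_k\ge1 \\ p_1+\cdots+p_k=n}}\alpha_k\big(\beta_{p_1}(b_{q_1+1},\ldots,b_{q_1+p_1}),\ldots,\beta_{p_k}(b_{q_k+1},\ldots,b_{q_k+p_k})\big),$$ where $q_j=p_1+\cdots+p_{j-1}$ (so $q_1=0$). Put $1=(1,0,0,\ldots)$ (identity for the formal product) and $I=(0,\mathrm{id}_B,0,0,\ldots)$ (identity for formal composition). $\alpha^{-1}$ denotes the inverse with respect to the formal product (it exists iff $\alpha_0$ is invertible) and $\alpha^{\langle-1\rangle}$ the inverse with respect to formal composition (for $\alpha_0=0$ it exists iff $\alpha_1$ is an invertible linear map $B\to B$). The distribution series of $a\in A$ is $\widetilde\Phi_a\in\mathrm{Mul}[[B]]$ with $\widetilde\Phi_{a,0}=E(a)$ and $\widetilde\Phi_{a,n}(b_1,\ldots,b_n)=E(ab_1ab_2\cdots ab_na)$ for $n\ge1$. For $\beta\in\mathrm{Mul}[[B]]$ with $\beta_0$ invertible, the unsymmetrized T-transform of $\beta$ is $\widetilde T_\beta=\big(\beta\circ(I\beta)^{\langle-1\rangle}\big)(1+I)^{-1}\in\mathrm{Mul}[[B]]$ (products are formal products). *)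

theory Defs
  imports Complex_Main "HOL.Hull"
begin

section \<open>B-valued noncommutative probability spaces\<close>

text \<open>
  Unital algebras live on types of sort \<open>{ring, monoid_mult}\<close>: a ring with a unit, not assumed
  commutative. The class \<open>ring_1\<close> would in addition exclude the zero algebra.
\<close>

locale unital_algebra = vector_space scale
  for scale :: "'k::field \<Rightarrow> 'a::{ring,monoid_mult} \<Rightarrow> 'a" +
  assumes scale_mult_left: "scale c x * y = scale c (x * y)"
    and mult_scale_right: "x * scale c y = scale c (x * y)"

text \<open>
  The inclusion of \<open>B\<close> into \<open>A\<close> as a unital subalgebra is an injective homomorphism \<open>\<iota>\<close>, and \<open>E\<close>
  takes values in \<open>B\<close> itself. The map on \<open>A\<close> is \<open>\<iota> \<circ> E\<close>; it is idempotent by \<open>E_embed\<close>.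
\<close>

locale valued_nc_prob_space =
  B: unital_algebra scaleB + A: unital_algebra scaleA
  for scaleB :: "'k::field \<Rightarrow> 'b::{ring,monoid_mult} \<Rightarrow> 'b"
    and scaleA :: "'k \<Rightarrow> 'a::{ring,monoid_mult} \<Rightarrow> 'a" +
  fixes \<iota> :: "'b \<Rightarrow> 'a" and E :: "'a \<Rightarrow> 'b"
  assumes embed_linear: "Vector_Spaces.linear scaleB scaleA \<iota>"
    and embed_mult: "\<iota> (b * c) = \<iota> b * \<iota> c"
    and embed_one: "\<iota> 1 = 1"
    and embed_inj: "inj \<iota>"
    and E_linear: "Vector_Spaces.linear scaleA scaleB E"
    and E_embed: "E (\<iota> b) = b"
    and E_bimodule: "E (\<iota> b * a * \<iota> c) = b * E a * c"

definition subalgebra :: "('k::field \<Rightarrow> 'a::{ring,monoid_mult} \<Rightarrow> 'a) \<Rightarrow> 'a set \<Rightarrow> bool"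
  where "subalgebra scale S \<longleftrightarrow>
    module.subspace scale S \<and> 1 \<in> S \<and> (\<forall>x\<in>S. \<forall>y\<in>S. x * y \<in> S)"

text \<open>
  Freeness of a family \<open>S\<close> of subalgebras indexed by \<open>J\<close>. In a word \<open>a\<^sub>1 \<cdots> a\<^sub>n\<close> the list \<open>js\<close> holds
  the indices; the word must be nonempty, since \<open>E 1 = 1\<close>.
\<close>

definition free_subalgebras ::
  "('k::field \<Rightarrow> 'a::{ring,monoid_mult} \<Rightarrow> 'a) \<Rightarrow> ('b::{ring,monoid_mult} \<Rightarrow> 'a) \<Rightarrow> ('a \<Rightarrow> 'b) \<Rightarrow>
    'j set \<Rightarrow> ('j \<Rightarrow> 'a set) \<Rightarrow> bool"
  where "free_subalgebras scaleA \<iota> E J S \<longleftrightarrow>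
    (\<forall>j\<in>J. subalgebra scaleA (S j) \<and> range \<iota> \<subseteq> S j) \<and>
    (\<forall>js as. length js = length as \<and> as \<noteq> [] \<and>
      (\<forall>m<length as. js ! m \<in> J \<and> as ! m \<in> S (js ! m) \<and> E (as ! m) = 0) \<and>
      (\<forall>m. Suc m < length as \<longrightarrow> js ! m \<noteq> js ! Suc m) \<longrightarrow>
      E (prod_list as) = 0)"

definition free_variables ::
  "('k::field \<Rightarrow> 'a::{ring,monoid_mult} \<Rightarrow> 'a) \<Rightarrow> ('b::{ring,monoid_mult} \<Rightarrow> 'a) \<Rightarrow> ('a \<Rightarrow> 'b) \<Rightarrow>
    'j set \<Rightarrow> ('j \<Rightarrow> 'a) \<Rightarrow> bool"
  where "free_variables scaleA \<iota> E J a \<longleftrightarrow>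
    free_subalgebras scaleA \<iota> E J (\<lambda>j. subalgebra scaleA hull (insert (a j) (range \<iota>)))"

definition invertible_elem :: "'b::monoid_mult \<Rightarrow> bool"
  where "invertible_elem b \<longleftrightarrow> (\<exists>c. b * c = 1 \<and> c * b = 1)"


section \<open>Formal multilinear function series\<close>

text \<open>
  A sequence \<open>(\<alpha>\<^sub>0, \<alpha>\<^sub>1, \<dots>)\<close> of functions, \<open>\<alpha>\<^sub>n\<close> of \<open>n\<close> arguments, is a single function on lists:
  \<open>\<alpha>\<^sub>n(b\<^sub>1, \<dots>, b\<^sub>n) = \<alpha> [b\<^sub>1, \<dots>, b\<^sub>n]\<close> and \<open>\<alpha>\<^sub>0 = \<alpha> []\<close>.
\<close>

type_synonym 'b mseries = "'b list \<Rightarrow> 'b"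

definition Mul :: "('k::field \<Rightarrow> 'b::{ring,monoid_mult} \<Rightarrow> 'b) \<Rightarrow> 'b mseries set"
  where "Mul scale = {\<alpha>. \<forall>us vs. Vector_Spaces.linear scale scale (\<lambda>b. \<alpha> (us @ b # vs))}"

definition mul_one :: "'b::{ring,monoid_mult} mseries"
  where "mul_one bs = (if bs = [] then 1 else 0)"

definition mul_id :: "'b::{ring,monoid_mult} mseries"
  where "mul_id bs = (case bs of [b] \<Rightarrow> b | _ \<Rightarrow> 0)"

definition mul_add :: "'b::{ring,monoid_mult} mseries \<Rightarrow> 'b mseries \<Rightarrow> 'b mseries"
    (infixl "\<oplus>" 65)
  where "(\<alpha> \<oplus> \<beta>) bs = \<alpha> bs + \<beta> bs"

definition mul_prod :: "'b::{ring,monoid_mult} mseries \<Rightarrow> 'b mseries \<Rightarrow> 'b mseries"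
    (infixl "\<odot>" 70)
  where "(\<alpha> \<odot> \<beta>) bs = (\<Sum>k\<le>length bs. \<alpha> (take k bs) * \<beta> (drop k bs))"

text \<open>
  Formal composition, meaningful when \<open>\<beta>\<^sub>0 = 0\<close>. Decompositions \<open>n = p\<^sub>1 + \<cdots> + p\<^sub>k\<close> with all
  \<open>p\<^sub>j \<ge> 1\<close> correspond to the ways of cutting \<open>[b\<^sub>1, \<dots>, b\<^sub>n]\<close> into \<open>k\<close> nonempty consecutive blocks,
  which are summed over here; \<open>mul_comp_Nil\<close> and \<open>mul_comp_eq\<close> give the formula in terms of the \<open>p\<^sub>j\<close>.
\<close>

definition mul_comp :: "'b::{ring,monoid_mult} mseries \<Rightarrow> 'b mseries \<Rightarrow> 'b mseries"
    (infixl "\<circledcirc>" 75)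
  where "(\<alpha> \<circledcirc> \<beta>) bs = (\<Sum>bss | concat bss = bs \<and> [] \<notin> set bss. \<alpha> (map \<beta> bss))"

lemma mul_comp_Nil: "(\<alpha> \<circledcirc> \<beta>) [] = \<alpha> []"
proof -
  have "{bss. concat bss = [] \<and> [] \<notin> set bss} = {[] :: 'a list list}"
    by (auto simp: concat_eq_Nil_conv) (metis list.set_intros(1) neq_Nil_conv)
  then show ?thesis by (simp add: mul_comp_def)
qed

fun blocks :: "nat list \<Rightarrow> 'b list \<Rightarrow> 'b list list" where
  "blocks [] bs = []"
| "blocks (p # ps) bs = take p bs # blocks ps (drop p bs)"

lemma blocks_conv:
  "blocks p bs = map (\<lambda>j. take (p ! j) (drop (sum_list (take j p)) bs)) [0..<length p]"
proof (induction p arbitrary: bs)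
  case (Cons q p)
  show ?case
    unfolding length_Cons upt_conv_Cons[OF zero_less_Suc] map_Suc_upt[symmetric]
    by (simp add: Cons.IH add.commute)
qed simp

lemma map_length_blocks: "sum_list p = length bs \<Longrightarrow> map length (blocks p bs) = p"
  by (induction p arbitrary: bs) auto

lemma concat_blocks: "sum_list p = length bs \<Longrightarrow> concat (blocks p bs) = bs"
  by (induction p arbitrary: bs) auto

lemma blocks_map_length: "blocks (map length bss) (concat bss) = bss"
  by (induction bss) auto

lemma finite_compositions: "finite {p :: nat list. sum_list p = n \<and> 0 \<notin> set p}"
proof (rule finite_subset)
  have "length p \<le> sum_list p" if "0 \<notin> set p" for p :: "nat list"
    using that by (induction p) auto
  then show "{p. sum_list p = n \<and> 0 \<notin> set p} \<subseteq> {p. set p \<subseteq> {..n} \<and> length p \<le> n}"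
    using member_le_sum_list by fastforce
qed (simp add: finite_lists_length_le)

lemma mul_comp_eq:
  assumes "length bs = n" and "n \<ge> 1"
  shows "(\<alpha> \<circledcirc> \<beta>) bs =
    (\<Sum>k = 1..n. \<Sum>p | length p = k \<and> (\<forall>j<k. p ! j \<ge> 1) \<and> sum_list p = n.
      \<alpha> (map (\<lambda>j. \<beta> (take (p ! j) (drop (sum_list (take j p)) bs))) [0..<k]))"
proof -
  let ?C = "{p :: nat list. sum_list p = n \<and> 0 \<notin> set p}"
  let ?f = "\<lambda>p. \<alpha> (map \<beta> (blocks p bs))"
  have nz: "0 \<notin> set p \<longleftrightarrow> (\<forall>j<length p. p ! j \<ge> 1)" for p :: "nat list"
    by (force simp: in_set_conv_nth Suc_le_eq)
  have len: "length p \<in> {1..n}" if "p \<in> ?C" for p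
  proof -
    have "length p \<le> sum_list p" if "0 \<notin> set p" for p :: "nat list"
      using that by (induction p) auto
    then have "length p \<le> n" using that by force
    then show ?thesis using that assms(2) by (cases p) auto
  qed
  have "(\<alpha> \<circledcirc> \<beta>) bs = sum ?f ?C"
    unfolding mul_comp_def
  proof (rule sum.reindex_bij_witness[where i = "\<lambda>p. blocks p bs" and j = "map length"])
    fix p assume p: "p \<in> ?C"
    then have eq: "map length (blocks p bs) = p"
      using assms(1) by (simp add: map_length_blocks)
    have "[] \<notin> set (blocks p bs)"
      using p eq by (metis (mono_tags, lifting) image_eqI list.size(3) mem_Collect_eq set_map)
    then show "blocks p bs \<in> {bss. concat bss = bs \<and> [] \<notin> set bss}"
      using p assms(1) by (simp add: concat_blocks)
    show "map length (blocks p bs) = p" by (rule eq)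
  qed (use assms(1) in \<open>auto simp: blocks_map_length length_concat\<close>)
  also have "\<dots> = (\<Sum>k = 1..n. sum ?f {p \<in> ?C. length p = k})"
    using len by (intro sum.group[symmetric] finite_compositions) auto
  also have "\<dots> = (\<Sum>k = 1..n. \<Sum>p | length p = k \<and> (\<forall>j<k. p ! j \<ge> 1) \<and> sum_list p = n.
      \<alpha> (map (\<lambda>j. \<beta> (take (p ! j) (drop (sum_list (take j p)) bs))) [0..<k]))"
    by (intro sum.cong) (auto simp: nz blocks_conv comp_def)
  finally show ?thesis .
qed

text \<open>The inverses in \<open>Mul scale\<close>; unspecified where there is none.\<close>

definition mul_inv :: "('k::field \<Rightarrow> 'b::{ring,monoid_mult} \<Rightarrow> 'b) \<Rightarrow> 'b mseries \<Rightarrow> 'b mseries"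
  where "mul_inv scale \<alpha> =
    (THE \<beta>. \<beta> \<in> Mul scale \<and> \<alpha> \<odot> \<beta> = mul_one \<and> \<beta> \<odot> \<alpha> = mul_one)"

definition mul_comp_inv :: "('k::field \<Rightarrow> 'b::{ring,monoid_mult} \<Rightarrow> 'b) \<Rightarrow> 'b mseries \<Rightarrow> 'b mseries"
  where "mul_comp_inv scale \<alpha> =
    (THE \<beta>. \<beta> \<in> Mul scale \<and> \<beta> [] = 0 \<and> \<alpha> \<circledcirc> \<beta> = mul_id \<and> \<beta> \<circledcirc> \<alpha> = mul_id)"


section \<open>Distribution series and unsymmetrized T-transform\<close>

definition distr_series ::
  "('b::{ring,monoid_mult} \<Rightarrow> 'a::{ring,monoid_mult}) \<Rightarrow> ('a \<Rightarrow> 'b) \<Rightarrow> 'a \<Rightarrow> 'b mseries"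
  where "distr_series \<iota> E a bs = E (a * prod_list (map (\<lambda>b. \<iota> b * a) bs))"

definition T_transform :: "('k::field \<Rightarrow> 'b::{ring,monoid_mult} \<Rightarrow> 'b) \<Rightarrow> 'b mseries \<Rightarrow> 'b mseries"
  where "T_transform scale \<beta> =
    (\<beta> \<circledcirc> mul_comp_inv scale (mul_id \<odot> \<beta>)) \<odot> mul_inv scale (mul_one \<oplus> mul_id)"

end

theory Submission
  imports Defs
begin

text \<open>
  Write \<open>w\<close> for the identity series \<open>I\<close> and \<open>R\<^sub>a(b) = a + a b a + a b a b a + \<cdots> = a (1 - b a)\<^sup>-\<^sup>1\<close>, so
  that \<open>\<Phi>\<^sub>a(b) = E (R\<^sub>a(b))\<close> and \<open>1 + b \<Phi>\<^sub>a(b) = E ((1 - b a)\<^sup>-\<^sup>1)\<close>. If \<open>b\<^sub>a\<close> is the compositional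
  inverse of \<open>I \<Phi>\<^sub>a\<close>, then \<open>E ((1 - b\<^sub>a a)\<^sup>-\<^sup>1) = 1 + w\<close> and \<open>T\<^sub>a (1 + w) = \<Phi>\<^sub>a(b\<^sub>a)\<close>. Put \<open>t = T\<^sub>y\<close>,
  \<open>w' = t w t\<^sup>-\<^sup>1\<close>, \<open>d = b\<^sub>y\<close> and \<open>c = b\<^sub>x \<circ> w'\<close>. The theorem amounts to the claim that the compositional
  inverse of \<open>I \<Phi>\<^sub>x\<^sub>y\<close> is \<open>b = t\<^sup>-\<^sup>1 c\<close>, that is, \<open>E ((1 - b x y)\<^sup>-\<^sup>1) = 1 + w\<close>: since \<open>b\<close> is \<open>w\<close> times a
  unit, and \<open>w\<close> can be cancelled on the left, \<open>b \<Phi>\<^sub>x\<^sub>y(b) = w\<close> determines \<open>\<Phi>\<^sub>x\<^sub>y(b)\<close>, which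
  comes out as \<open>T\<^sub>x(w') t (1 + w)\<close>.

  For the claim, let \<open>P = (1 - c x)\<^sup>-\<^sup>1\<close> and \<open>Q = (1 - d y)\<^sup>-\<^sup>1\<close>, and split off the centred parts
  \<open>p = P - (1 + w')\<close> and \<open>r = R\<^sub>y(d) - t (1 + w)\<close>. Written in terms of \<open>p\<close> and \<open>r\<close>, the element
  \<open>P (t - c x y) Q\<close> has no term that contains only one of them. For \<open>r\<close> this is due to the choice of
  \<open>w'\<close>, and the outcome is
  \<open>1 - b x y = t\<^sup>-\<^sup>1 P\<^sup>-\<^sup>1 (t (1 + w) - p (1 + w')\<^sup>-\<^sup>1 r) Q\<^sup>-\<^sup>1\<close> (lemma \<open>resolvent_factorisation\<close>). Inverting
  the middle factor by a geometric series expresses \<open>(1 - b x y)\<^sup>-\<^sup>1\<close> as \<open>(1 + w) s (1 + w') t\<close> with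
  \<open>s = (1 + w)\<^sup>-\<^sup>1 t\<^sup>-\<^sup>1\<close> plus terms that alternate between \<open>p\<close> and \<open>r\<close>, with coefficients from \<open>B\<close>
  between them and at either end. By freeness \<open>E\<close> kills all of these (lemma \<open>free_product_resolvent\<close>), and what is left is
  \<open>t\<^sup>-\<^sup>1 (1 + w') t = 1 + w\<close>.

  The manipulations take place in the ring of all functions from words over \<open>B\<close> to \<open>A\<close> (or to \<open>B\<close>)
  under the formal product. Substituting a \<open>B\<close>-valued series is a ring homomorphism on it
  (\<open>comp_mult\<close>), and \<open>E\<close>, applied coefficientwise, is a bimodule map over the \<open>B\<close>-valued series,
  just as \<open>E\<close> itself is over \<open>B\<close>. Multilinearity enters through the associativity of composition
  (\<open>comp_assoc\<close>), which compares substituting \<open>c = b\<^sub>x \<circ> w'\<close> with substituting \<open>b\<^sub>x\<close> and then \<open>w'\<close>.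
\<close>

section \<open>Splitting and cutting words\<close>

text \<open>
  The formal product sums over all ways to split a word in two, and composition over all ways to cut
  it into nonempty blocks. Both are computed by recursion on the first letter, which turns the
  identities between iterated sums into inductions.
\<close>

definition splits :: "'c list \<Rightarrow> ('c list \<times> 'c list) set"
  where "splits bs = {(us, vs). us @ vs = bs}"

definition cuts :: "'c list \<Rightarrow> 'c list list set"
  where "cuts bs = {bss. concat bss = bs \<and> [] \<notin> set bss}"

lemma splits_Nil [simp]: "splits [] = {([], [])}"
  by (auto simp: splits_def)

lemma splits_Cons: "splits (b # bs) = insert ([], b # bs) ((\<lambda>(u, v). (b # u, v)) ` splits bs)"
  by (auto simp: splits_def append_eq_Cons_conv image_iff)

lemma finite_splits [simp]: "finite (splits bs)"
  by (induction bs) (auto simp: splits_Cons)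

lemma splits_eq_take_drop: "splits bs = (\<lambda>k. (take k bs, drop k bs)) ` {..length bs}"
proof -
  have "(u, v) \<in> (\<lambda>k. (take k (u @ v), drop k (u @ v))) ` {..length (u @ v)}" for u v :: "'a list"
    by (rule image_eqI[of _ _ "length u"]) auto
  then show ?thesis by (auto simp: splits_def)
qed

lemma sum_splits_Cons:
  "(\<Sum>(u, v)\<in>splits (b # bs). F u v) = F [] (b # bs) + (\<Sum>(u, v)\<in>splits bs. F (b # u) v)"
proof -
  have "(\<Sum>(u, v)\<in>splits (b # bs). F u v) =
      F [] (b # bs) + (\<Sum>(u, v)\<in>(\<lambda>(u, v). (b # u, v)) ` splits bs. F u v)"
    unfolding splits_Cons by (subst sum.insert) auto
  also have "(\<Sum>(u, v)\<in>(\<lambda>(u, v). (b # u, v)) ` splits bs. F u v) =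
      (\<Sum>(u, v)\<in>splits bs. F (b # u) v)"
    by (subst sum.reindex) (auto simp: inj_on_def comp_def case_prod_beta)
  finally show ?thesis .
qed

lemma sum_splits_distrib:
  "(\<Sum>(u, v)\<in>splits bs. F u v + G u v) =
    (\<Sum>(u, v)\<in>splits bs. F u v) + (\<Sum>(u, v)\<in>splits bs. G u v)"
  by (simp add: case_prod_beta sum.distrib)

lemma sum_splits_single:
  assumes "a @ b = bs" and "\<And>u v. u @ v = bs \<Longrightarrow> (u, v) \<noteq> (a, b) \<Longrightarrow> F u v = 0"
  shows "(\<Sum>(u, v)\<in>splits bs. F u v) = F a b"
proof -
  have "(\<Sum>(u, v)\<in>splits bs. F u v) = (\<Sum>(u, v)\<in>{(a, b)}. F u v)"
    using assms by (intro sum.mono_neutral_right finite_splits) (auto simp: splits_def)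
  then show ?thesis by simp
qed

lemma sum_splits_append:
  "(\<Sum>(u, v)\<in>splits (us @ b # vs). F u v) =
    (\<Sum>(p, q)\<in>splits us. F p (q @ b # vs)) + (\<Sum>(p, q)\<in>splits vs. F (us @ b # p) q)"
  by (induction us arbitrary: F) (simp_all add: sum_splits_Cons add.assoc)

lemma sum_splits_assoc:
  "(\<Sum>(p, w)\<in>splits bs. \<Sum>(u, v)\<in>splits p. F u v w) =
    (\<Sum>(u, q)\<in>splits bs. \<Sum>(v, w)\<in>splits q. F u v w)"
proof (induction bs arbitrary: F)
  case (Cons b bs)
  show ?case
    using Cons.IH[of "\<lambda>u. F (b # u)"]
    by (simp add: sum_splits_Cons sum_splits_distrib add.assoc)
qed simp

lemma sum_splits_map:
  "(\<Sum>(u, v)\<in>splits (map f bs). F u v) = (\<Sum>(u, v)\<in>splits bs. F (map f u) (map f v))"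
  by (induction bs arbitrary: F) (simp_all add: sum_splits_Cons)

lemma splits_length: "(u, v) \<in> splits bs \<Longrightarrow> length u + length v = length bs"
  by (auto simp: splits_def)

lemma cuts_Nil [simp]: "cuts [] = {[]}"
proof -
  have "bss = []" if "concat bss = []" "[] \<notin> set bss" for bss :: "'a list list"
    using that by (cases bss) auto
  then show ?thesis by (auto simp: cuts_def)
qed

lemma cuts_Cons: "cuts (b # bs) = (\<Union>(p, q)\<in>splits bs. (\<lambda>c. (b # p) # c) ` cuts q)"
proof (rule set_eqI)
  fix c
  show "c \<in> cuts (b # bs) \<longleftrightarrow> c \<in> (\<Union>(p, q)\<in>splits bs. (\<lambda>c. (b # p) # c) ` cuts q)"
  proof (cases c)
    case (Cons d ds)
    then show ?thesis by (cases d) (auto simp: cuts_def splits_def image_iff)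
  qed (auto simp: cuts_def)
qed

lemma finite_cuts [simp]: "finite (cuts bs)"
proof (induction bs rule: length_induct)
  case (1 bs)
  then show ?case
    by (cases bs) (auto simp: cuts_Cons intro!: finite_imageI dest: splits_length)
qed

lemma sum_cuts_Cons:
  "(\<Sum>c\<in>cuts (b # bs). F c) = (\<Sum>(p, q)\<in>splits bs. \<Sum>c\<in>cuts q. F ((b # p) # c))"
proof -
  have "(\<Sum>c\<in>cuts (b # bs). F c) =
      (\<Sum>z\<in>splits bs. sum F (case z of (p, q) \<Rightarrow> (\<lambda>c. (b # p) # c) ` cuts q))"
    unfolding cuts_Cons
    by (rule sum.UNION_disjoint[OF finite_splits]) (auto simp: splits_def)
  also have "\<dots> = (\<Sum>(p, q)\<in>splits bs. \<Sum>c\<in>cuts q. F ((b # p) # c))"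
    by (rule sum.cong) (auto simp: sum.reindex inj_on_def)
  finally show ?thesis .
qed

lemma sum_cuts_map:
  fixes F :: "'c list list \<Rightarrow> 'm::comm_monoid_add"
  shows "(\<Sum>c\<in>cuts (map f bs). F c) = (\<Sum>c\<in>cuts bs. F (map (map f) c))"
proof (induction bs arbitrary: F rule: length_induct)
  case (1 bs)
  show ?case
  proof (cases bs)
    case (Cons b r)
    have IH: "(\<Sum>c\<in>cuts (map f q). G c) = (\<Sum>c\<in>cuts q. G (map (map f) c))"
      if "(p, q) \<in> splits r" for p q and G :: "'c list list \<Rightarrow> 'm"
      using 1 that Cons by (auto dest!: splits_length)
    have "(\<Sum>c\<in>cuts (map f bs). F c) =
        (\<Sum>(p, q)\<in>splits r. \<Sum>c\<in>cuts (map f q). F ((f b # map f p) # c))"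
      by (simp add: Cons sum_cuts_Cons sum_splits_map)
    also have "\<dots> = (\<Sum>(p, q)\<in>splits r. \<Sum>c\<in>cuts q. F ((f b # map f p) # map (map f) c))"
      by (rule sum.cong) (auto simp: IH)
    finally show ?thesis by (simp add: Cons sum_cuts_Cons)
  qed simp
qed

text \<open>
  This is the combinatorial content of \<open>(\<alpha> \<alpha>') \<circ> \<beta> = (\<alpha> \<circ> \<beta>) (\<alpha>' \<circ> \<beta>)\<close>: separating the blocks of a cut
  into an initial and a final group is the same as splitting the word first and cutting both parts.
\<close>

lemma sum_cuts_splits:
  fixes F :: "'c list list \<Rightarrow> 'c list list \<Rightarrow> 'm::comm_monoid_add"
  shows "(\<Sum>c\<in>cuts bs. \<Sum>(x, y)\<in>splits c. F x y) =
    (\<Sum>(u, v)\<in>splits bs. \<Sum>x\<in>cuts u. \<Sum>y\<in>cuts v. F x y)"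
proof (induction bs arbitrary: F rule: length_induct)
  case (1 bs)
  show ?case
  proof (cases bs)
    case (Cons b r)
    have IH: "(\<Sum>c\<in>cuts q. \<Sum>(x, y)\<in>splits c. G x y) =
        (\<Sum>(u, v)\<in>splits q. \<Sum>x\<in>cuts u. \<Sum>y\<in>cuts v. G x y)"
      if "(p, q) \<in> splits r" for p q and G :: "'c list list \<Rightarrow> 'c list list \<Rightarrow> 'm"
      using 1 that Cons by (auto dest!: splits_length)
    have "(\<Sum>c\<in>cuts bs. \<Sum>(x, y)\<in>splits c. F x y) =
        (\<Sum>(p, q)\<in>splits r. \<Sum>c\<in>cuts q. F [] ((b # p) # c)) +
        (\<Sum>(p, q)\<in>splits r. \<Sum>c\<in>cuts q. \<Sum>(x, y)\<in>splits c. F ((b # p) # x) y)"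
      by (simp add: Cons sum_cuts_Cons sum_splits_Cons sum.distrib sum_splits_distrib)
    also have "(\<Sum>(p, q)\<in>splits r. \<Sum>c\<in>cuts q. \<Sum>(x, y)\<in>splits c. F ((b # p) # x) y) =
        (\<Sum>(p, q)\<in>splits r. \<Sum>(u, v)\<in>splits q.
          \<Sum>x\<in>cuts u. \<Sum>y\<in>cuts v. F ((b # p) # x) y)"
      by (rule sum.cong) (auto simp: IH)
    also have "\<dots> = (\<Sum>(u, v)\<in>splits r. \<Sum>(p, q)\<in>splits u.
          \<Sum>x\<in>cuts q. \<Sum>y\<in>cuts v. F ((b # p) # x) y)"
      by (rule sum_splits_assoc[symmetric])
    also have "\<dots> = (\<Sum>(u, v)\<in>splits r. \<Sum>x\<in>cuts (b # u). \<Sum>y\<in>cuts v. F x y)"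
      by (simp add: sum_cuts_Cons)
    finally show ?thesis by (simp add: Cons sum_splits_Cons sum_cuts_Cons)
  qed simp
qed


section \<open>The ring of noncommutative series\<close>

text \<open>
  A separate type lets the formal product be the multiplication of the classes \<open>ring\<close> and
  \<open>monoid_mult\<close>. Letters and values have independent types because the resolvents below are \<open>A\<close>-valued
  series in letters from \<open>B\<close>.
\<close>

typedef ('c, 'a) series = "UNIV :: ('c list \<Rightarrow> 'a) set"
  morphisms coeff Series by simp

setup_lifting type_definition_series

lemma coeff_Series [simp]: "coeff (Series f) = f"
  by (simp add: Series_inverse)

lemma series_eqI: "(\<And>bs. coeff f bs = coeff g bs) \<Longrightarrow> f = g"
  by (simp add: coeff_inject[symmetric] fun_eq_iff)

instantiation series :: (type, ring) ring
begin

lift_definition zero_series :: "('a, 'b) series" is "\<lambda>_. 0" .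
lift_definition plus_series :: "('a, 'b) series \<Rightarrow> ('a, 'b) series \<Rightarrow> ('a, 'b) series"
  is "\<lambda>f g bs. f bs + g bs" .
lift_definition minus_series :: "('a, 'b) series \<Rightarrow> ('a, 'b) series \<Rightarrow> ('a, 'b) series"
  is "\<lambda>f g bs. f bs - g bs" .
lift_definition uminus_series :: "('a, 'b) series \<Rightarrow> ('a, 'b) series"
  is "\<lambda>f bs. - f bs" .
lift_definition times_series :: "('a, 'b) series \<Rightarrow> ('a, 'b) series \<Rightarrow> ('a, 'b) series"
  is "\<lambda>f g bs. \<Sum>(us, vs)\<in>splits bs. f us * g vs" .

instance
proof
  fix f g h :: "('a, 'b) series"
  show "f * g * h = f * (g * h)"
  proof (transfer, rule ext)
    fix f g h :: "'a list \<Rightarrow> 'b" and bs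
    show "(\<Sum>(p, w)\<in>splits bs. (\<Sum>(u, v)\<in>splits p. f u * g v) * h w) =
        (\<Sum>(u, q)\<in>splits bs. f u * (\<Sum>(v, w)\<in>splits q. g v * h w))"
      using sum_splits_assoc[of "\<lambda>u v w. f u * g v * h w" bs]
      by (simp add: sum_distrib_left sum_distrib_right case_prod_beta mult.assoc)
  qed
qed (transfer; simp add: fun_eq_iff algebra_simps sum.distrib case_prod_beta)+

end

instantiation series :: (type, "{ring,monoid_mult}") monoid_mult
begin

lift_definition one_series :: "('a, 'b) series" is "\<lambda>bs. if bs = [] then 1 else 0" .

instance
proof
  fix f :: "('a, 'b) series"
  show "1 * f = f"
  proof (transfer, rule ext)
    fix f :: "'a list \<Rightarrow> 'b" and bs
    show "(\<Sum>(u, v)\<in>splits bs. (if u = [] then 1 else 0) * f v) = f bs"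
      by (subst sum_splits_single[of "[]" bs]) auto
  qed
  show "f * 1 = f"
  proof (transfer, rule ext)
    fix f :: "'a list \<Rightarrow> 'b" and bs
    show "(\<Sum>(u, v)\<in>splits bs. f u * (if v = [] then 1 else 0)) = f bs"
      by (subst sum_splits_single[of bs "[]"]) auto
  qed
qed

end

lemmas coeff_zero [simp] = zero_series.rep_eq
lemmas coeff_one = one_series.rep_eq
lemmas coeff_add [simp] = plus_series.rep_eq
lemmas coeff_minus [simp] = minus_series.rep_eq
lemmas coeff_uminus [simp] = uminus_series.rep_eq
lemmas coeff_mult = times_series.rep_eq

lemma coeff_one_Nil [simp]: "coeff 1 [] = 1"
  by (simp add: coeff_one)

lemma coeff_mult_Nil [simp]: "coeff (f * g) [] = coeff f [] * coeff g []"
  by (simp add: coeff_mult)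

definition const :: "'a::{ring,monoid_mult} \<Rightarrow> ('c, 'a) series"
  where "const a = Series (\<lambda>bs. if bs = [] then a else 0)"

lemma coeff_const: "coeff (const a) bs = (if bs = [] then a else 0)"
  by (simp add: const_def)

lemma coeff_const_mult [simp]: "coeff (const a * f) bs = a * coeff f bs"
  unfolding coeff_mult by (subst sum_splits_single[of "[]" bs]) (auto simp: coeff_const)

lemma coeff_mult_const [simp]: "coeff (f * const a) bs = coeff f bs * a"
  unfolding coeff_mult by (subst sum_splits_single[of bs "[]"]) (auto simp: coeff_const)

definition var :: "('a, 'a::{ring,monoid_mult}) series"
  where "var = Series mul_id"

lemma coeff_var_Nil [simp]: "coeff var [] = 0"
  by (simp add: var_def mul_id_def)

lemma coeff_var_mult_Cons [simp]: "coeff (var * f) (b # bs) = b * coeff f bs"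
  unfolding coeff_mult
  by (subst sum_splits_single[of "[b]" bs])
    (auto simp: var_def mul_id_def append_eq_Cons_conv split: list.split)

text \<open>
  The \<open>bs\<close>-coefficient of \<open>f\<close> is the coefficient of \<open>var * f\<close> at the word with an extra first letter
  \<open>1\<close>. So the variable can be cancelled on the left although it has no inverse.
\<close>

lemma var_mult_left_cancel:
  assumes "var * f = var * g" shows "f = g"
proof (rule series_eqI)
  fix bs
  have "coeff (var * f) (1 # bs) = coeff (var * g) (1 # bs)" using assms by simp
  then show "coeff f bs = coeff g bs" by simp
qed

section \<open>Composition\<close>

definition series_comp :: "('c, 'a::ring) series \<Rightarrow> ('b, 'c) series \<Rightarrow> ('b, 'a) series"
    (infixl "\<circ>\<^sub>s" 75)
  where "f \<circ>\<^sub>s h = Series (\<lambda>bs. \<Sum>c\<in>cuts bs. coeff f (map (coeff h) c))"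

lemma coeff_comp: "coeff (f \<circ>\<^sub>s h) bs = (\<Sum>c\<in>cuts bs. coeff f (map (coeff h) c))"
  by (simp add: series_comp_def)

lemma coeff_comp_Nil [simp]: "coeff (f \<circ>\<^sub>s h) [] = coeff f []"
  by (simp add: coeff_comp)

lemma comp_add: "(f + g) \<circ>\<^sub>s h = f \<circ>\<^sub>s h + g \<circ>\<^sub>s h"
  by (rule series_eqI) (simp add: coeff_comp sum.distrib)

lemma comp_mult: "(f * g) \<circ>\<^sub>s h = (f \<circ>\<^sub>s h) * (g \<circ>\<^sub>s h)"
  by (rule series_eqI)
    (simp add: coeff_comp coeff_mult sum_splits_map sum_cuts_splits sum_product)

lemma comp_const [simp]: "const a \<circ>\<^sub>s h = const a"
proof (rule series_eqI)
  fix bs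
  show "coeff (const a \<circ>\<^sub>s h) bs = coeff (const a) bs"
    by (cases bs) (simp_all add: coeff_comp coeff_const sum_cuts_Cons)
qed

lemma comp_one [simp]: "1 \<circ>\<^sub>s h = 1"
proof (rule series_eqI)
  fix bs
  show "coeff (1 \<circ>\<^sub>s h) bs = coeff 1 bs"
    by (cases bs) (simp_all add: coeff_comp coeff_one sum_cuts_Cons)
qed

lemma var_comp:
  assumes "coeff h [] = 0" shows "var \<circ>\<^sub>s h = h"
proof (rule series_eqI)
  fix bs
  show "coeff (var \<circ>\<^sub>s h) bs = coeff h bs"
  proof (cases bs)
    case (Cons b r)
    have "coeff (var \<circ>\<^sub>s h) bs =
        (\<Sum>(p, q)\<in>splits r. \<Sum>c\<in>cuts q. if c = [] then coeff h (b # p) else 0)"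
      unfolding Cons coeff_comp sum_cuts_Cons
    proof (rule sum.cong[OF refl], clarify, rule sum.cong[OF refl])
      fix p c
      show "coeff var (map (coeff h) ((b # p) # c)) = (if c = [] then coeff h (b # p) else 0)"
        by (cases c) (simp_all add: var_def mul_id_def)
    qed
    also have "\<dots> = coeff h (b # r)"
    proof (subst sum_splits_single[of r "[]"])
      show "(\<Sum>c\<in>cuts v. if c = [] then coeff h (b # u) else 0) = 0"
        if "u @ v = r" "(u, v) \<noteq> (r, [])" for u v
        using that by (cases v) (auto simp: sum_cuts_Cons)
    qed simp_all
    finally show ?thesis by (simp add: Cons)
  qed (simp add: assms)
qed

lemma mul_one_eq: "mul_one = coeff 1"
  by (simp add: fun_eq_iff mul_one_def coeff_one)

lemma mul_id_eq: "mul_id = coeff var"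
  by (simp add: var_def)

lemma mul_add_eq: "coeff f \<oplus> coeff g = coeff (f + g)"
  by (simp add: fun_eq_iff mul_add_def)

lemma mul_prod_eq: "coeff f \<odot> coeff g = coeff (f * g)"
proof
  fix bs :: "'a list"
  have "inj_on (\<lambda>k. (take k bs, drop k bs)) {..length bs}"
    by (rule inj_on_inverseI[where g = "\<lambda>(u, v). length u"]) simp
  then show "(coeff f \<odot> coeff g) bs = coeff (f * g) bs"
    by (simp add: mul_prod_def coeff_mult splits_eq_take_drop sum.reindex)
qed

lemma mul_comp_series: "coeff f \<circledcirc> coeff g = coeff (f \<circ>\<^sub>s g)"
  by (simp add: fun_eq_iff mul_comp_def coeff_comp cuts_def)

lemmas mul_eqs = mul_one_eq mul_id_eq mul_add_eq mul_prod_eq mul_comp_series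

section \<open>Geometric series\<close>

text \<open>
  The series \<open>1 + w + w w + \<cdots>\<close>, whose coefficient at a word is the product of its letters. Composing
  it with \<open>n\<close> gives the formal inverse of \<open>1 - n\<close> with no need for infinite sums.
\<close>

definition geometric :: "('a, 'a::{ring,monoid_mult}) series"
  where "geometric = Series prod_list"

lemma geometric_unfold: "geometric = 1 + var * geometric"
proof (rule series_eqI)
  fix bs :: "'a list"
  show "coeff geometric bs = coeff (1 + var * geometric) bs"
    by (cases bs) (simp_all add: geometric_def coeff_one)
qed

lemma geometric_right_inverse:
  assumes "coeff n [] = 0"
  shows "(1 - n) * (geometric \<circ>\<^sub>s n) = 1"
proof -
  have "geometric \<circ>\<^sub>s n = 1 + n * (geometric \<circ>\<^sub>s n)"
    by (subst geometric_unfold) (simp add: comp_add comp_mult var_comp[OF assms])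
  then show ?thesis unfolding left_diff_distrib mult_1_left diff_eq_eq .
qed

text \<open>
  The series \<open>V = geometric \<circ> n\<close> has constant term \<open>1\<close>, hence a right inverse of the same kind. As
  \<open>1 - n\<close> is a left inverse of \<open>V\<close>, the two agree.
\<close>

lemma geometric_left_inverse:
  assumes "coeff n [] = 0"
  shows "(geometric \<circ>\<^sub>s n) * (1 - n) = 1"
proof -
  let ?V = "geometric \<circ>\<^sub>s n"
  let ?W = "geometric \<circ>\<^sub>s (1 - ?V)"
  have "coeff (1 - ?V) [] = 0" by (simp add: geometric_def)
  from geometric_right_inverse[OF this] have VW: "?V * ?W = 1" by simp
  have "1 - n = (1 - n) * (?V * ?W)" by (simp only: VW mult.right_neutral)
  also have "\<dots> = ?W"
    by (simp only: geometric_right_inverse[OF assms] mult.assoc[symmetric] mult.left_neutral)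
  finally have "1 - n = ?W" .
  with VW show ?thesis by simp
qed


section \<open>Multilinear series\<close>

text \<open>
  Fixing the first argument of \<open>f\<close> keeps it multilinear, so facts on \<open>f \<circ> h\<close> can be proved by
  induction on the word for all \<open>f\<close> at once: the first block of a cut is absorbed into \<open>f\<close>.
\<close>

definition shift :: "'c \<Rightarrow> ('c, 'a) series \<Rightarrow> ('c, 'a) series"
  where "shift c f = Series (\<lambda>cs. coeff f (c # cs))"

lemma coeff_shift [simp]: "coeff (shift c f) cs = coeff f (c # cs)"
  by (simp add: shift_def)

lemma coeff_comp_Cons:
  "coeff (f \<circ>\<^sub>s h) (b # r) = (\<Sum>(p, q)\<in>splits r. coeff (shift (coeff h (b # p)) f \<circ>\<^sub>s h) q)"
  by (simp add: coeff_comp sum_cuts_Cons)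

context unital_algebra
begin

definition lin :: "('a \<Rightarrow> 'a) \<Rightarrow> bool"
  where "lin F \<longleftrightarrow> (\<forall>x y. F (x + y) = F x + F y) \<and> (\<forall>c x. F (scale c x) = scale c (F x))"

definition multilinear :: "('a, 'a) series \<Rightarrow> bool"
  where "multilinear f \<longleftrightarrow> (\<forall>us vs. lin (\<lambda>b. coeff f (us @ b # vs)))"

lemma multilinear_iff_Mul: "multilinear f \<longleftrightarrow> coeff f \<in> Mul scale"
  using vector_space_axioms
  by (auto simp: multilinear_def Mul_def lin_def Vector_Spaces.linear_iff)

lemma lin_zero: "lin (\<lambda>b. 0)"
  by (simp add: lin_def)

lemma lin_id: "lin (\<lambda>b. b)"
  by (simp add: lin_def)

lemma lin_add: "lin F \<Longrightarrow> lin G \<Longrightarrow> lin (\<lambda>b. F b + G b)"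
  by (simp add: lin_def scale_right_distrib)

lemma lin_diff: "lin F \<Longrightarrow> lin G \<Longrightarrow> lin (\<lambda>b. F b - G b)"
  by (simp add: lin_def scale_right_diff_distrib)

lemma lin_mult_left: "lin F \<Longrightarrow> lin (\<lambda>b. a * F b)"
  by (simp add: lin_def distrib_left mult_scale_right)

lemma lin_mult_right: "lin F \<Longrightarrow> lin (\<lambda>b. F b * a)"
  by (simp add: lin_def distrib_right scale_mult_left)

lemma lin_sum: "(\<And>i. i \<in> S \<Longrightarrow> lin (F i)) \<Longrightarrow> lin (\<lambda>b. \<Sum>i\<in>S. F i b)"
  by (simp add: lin_def sum.distrib scale_sum_right)

lemma lin_compose: "lin F \<Longrightarrow> lin G \<Longrightarrow> lin (\<lambda>b. F (G b))"
  by (simp add: lin_def)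

lemma lin_apply_sum:
  assumes "lin F" "finite S"
  shows "F (\<Sum>i\<in>S. g i) = (\<Sum>i\<in>S. F (g i))"
proof -
  have "F (0 + 0) = F 0 + F 0" using assms(1) unfolding lin_def by blast
  then have "F 0 = 0" by simp
  with assms(2) show ?thesis
    by induction (use assms(1) in \<open>simp_all add: lin_def\<close>)
qed

lemma lin_at_zero:
  assumes "lin F" shows "F 0 = 0"
  using lin_apply_sum[OF assms, of "{}"] by simp

lemma multilinear_Cons: "multilinear f \<Longrightarrow> lin (\<lambda>b. coeff f (b # vs))"
  unfolding multilinear_def by (drule spec[of _ "[]"]) simp

lemma multilinear_const: "multilinear (const a)"
  by (simp add: multilinear_def coeff_const lin_zero)

lemma multilinear_one: "multilinear 1"
  by (simp add: multilinear_def coeff_one lin_zero)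

lemma multilinear_zero: "multilinear 0"
  by (simp add: multilinear_def lin_zero)

lemma multilinear_var: "multilinear var"
  unfolding multilinear_def
proof (intro allI)
  fix us vs :: "'a list"
  show "lin (\<lambda>b. coeff var (us @ b # vs))"
  proof (cases us)
    case Nil
    then show ?thesis by (cases vs) (simp_all add: var_def mul_id_def lin_zero lin_id)
  next
    case (Cons a as)
    then show ?thesis by (cases as) (simp_all add: var_def mul_id_def lin_zero)
  qed
qed

lemma multilinear_geometric: "multilinear geometric"
  by (simp add: multilinear_def geometric_def lin_mult_left lin_mult_right lin_id)

lemma multilinear_add: "multilinear f \<Longrightarrow> multilinear g \<Longrightarrow> multilinear (f + g)"
  by (simp add: multilinear_def lin_add)

lemma multilinear_diff: "multilinear f \<Longrightarrow> multilinear g \<Longrightarrow> multilinear (f - g)"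
  by (simp add: multilinear_def lin_diff)

lemma multilinear_shift: "multilinear f \<Longrightarrow> multilinear (shift c f)"
proof -
  assume "multilinear f"
  then have "lin (\<lambda>b. coeff f ((c # us) @ b # vs))" for us vs
    unfolding multilinear_def by blast
  then show ?thesis by (simp add: multilinear_def)
qed

lemma multilinear_mult:
  assumes "multilinear f" "multilinear g"
  shows "multilinear (f * g)"
  unfolding multilinear_def
proof (intro allI)
  fix us vs
  show "lin (\<lambda>b. coeff (f * g) (us @ b # vs))"
    unfolding coeff_mult sum_splits_append case_prod_beta
    using assms unfolding multilinear_def
    by (intro lin_add lin_sum lin_mult_left lin_mult_right) auto
qed

text \<open>
  In the recursion on the first block, the letter that varies lies either in that block, where
  linearity of \<open>f\<close> in its first argument applies, or behind it, where the induction hypothesis for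
  \<open>shift\<close> does.
\<close>

lemma multilinear_comp:
  assumes "multilinear f" "multilinear h"
  shows "multilinear (f \<circ>\<^sub>s h)"
  unfolding multilinear_def
proof (intro allI)
  fix us vs
  have h: "lin (\<lambda>b. coeff h (us @ b # vs))" for us vs
    using assms(2) unfolding multilinear_def by blast
  have first: "lin (\<lambda>b. coeff (shift (coeff h (us @ b # p)) f \<circ>\<^sub>s h) q)"
    if "multilinear f" for us p q f
    unfolding coeff_comp coeff_shift
    by (intro lin_sum lin_compose[OF multilinear_Cons[OF that] h])
  show "lin (\<lambda>b. coeff (f \<circ>\<^sub>s h) (us @ b # vs))"
    using assms(1)
  proof (induction us arbitrary: f rule: length_induct)
    case (1 us)
    show ?case
    proof (cases us)
      case Nil
      show ?thesis
        unfolding Nil append_Nil coeff_comp_Cons case_prod_beta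
        by (intro lin_sum first[of f "[]", unfolded append_Nil] \<open>multilinear f\<close>)
    next
      case (Cons c us')
      have IH: "lin (\<lambda>b. coeff (shift (coeff h (c # fst z)) f \<circ>\<^sub>s h) (snd z @ b # vs))"
        if "z \<in> splits us'" for z
        using 1 that Cons by (auto simp: case_prod_beta multilinear_shift dest!: splits_length[of "fst z" "snd z", simplified])
      show ?thesis
        unfolding Cons append_Cons coeff_comp_Cons sum_splits_append case_prod_beta
        by (intro lin_add lin_sum IH first[of f "c # us'", unfolded append_Cons] \<open>multilinear f\<close>)
    qed
  qed
qed

lemma comp_var:
  assumes "multilinear f"
  shows "f \<circ>\<^sub>s var = f"
proof (rule series_eqI)
  fix bs
  show "coeff (f \<circ>\<^sub>s var) bs = coeff f bs"
    using assms
  proof (induction bs arbitrary: f)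
    case (Cons b r)
    have "coeff (f \<circ>\<^sub>s var) (b # r) = coeff (shift (coeff var [b]) f \<circ>\<^sub>s var) r"
      unfolding coeff_comp_Cons
    proof (rule sum_splits_single)
      fix p q assume "p @ q = r" "(p, q) \<noteq> ([], r)"
      then have "coeff var (b # p) = 0" by (cases p) (auto simp: var_def mul_id_def)
      then show "coeff (shift (coeff var (b # p)) f \<circ>\<^sub>s var) q = 0"
        using lin_at_zero[OF multilinear_Cons[OF Cons.prems]] by (simp add: coeff_comp)
    qed simp
    also have "\<dots> = coeff f (b # r)"
      using Cons.IH[OF multilinear_shift[OF Cons.prems]] by (simp add: var_def mul_id_def)
    finally show ?case .
  qed simp
qed

text \<open>
  Additivity of \<open>f\<close> is what expands the sums \<open>(g \<circ> h)(block)\<close> in its arguments. After the expansion,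
  both sides sum over the ways to cut the word into blocks and these blocks into smaller ones.
\<close>

lemma comp_assoc:
  assumes "multilinear f"
  shows "(f \<circ>\<^sub>s g) \<circ>\<^sub>s h = f \<circ>\<^sub>s (g \<circ>\<^sub>s h)"
proof (rule series_eqI)
  fix bs
  show "coeff ((f \<circ>\<^sub>s g) \<circ>\<^sub>s h) bs = coeff (f \<circ>\<^sub>s (g \<circ>\<^sub>s h)) bs"
    using assms
  proof (induction bs arbitrary: f rule: length_induct)
    case (1 bs)
    show ?case
    proof (cases bs)
      case (Cons b r)
      let ?hd = "\<lambda>x. coeff g (map (coeff h) x)"
      have IH: "(\<Sum>y\<in>cuts v. \<Sum>C\<in>cuts y. coeff f (c # map ?hd C)) =
          (\<Sum>d\<in>cuts v. coeff f (c # map (coeff (g \<circ>\<^sub>s h)) d))"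
        if "(u, v) \<in> splits r" for u v c
        using 1(1)[rule_format, of v "shift c f"] 1(2) that Cons
        by (auto simp: multilinear_shift coeff_comp[of _ h] coeff_comp[of _ g] coeff_comp[of _ "g \<circ>\<^sub>s h"]
            sum_cuts_map comp_def dest!: splits_length)
      have "coeff ((f \<circ>\<^sub>s g) \<circ>\<^sub>s h) bs =
          (\<Sum>(p, q)\<in>splits r. \<Sum>c\<in>cuts q. \<Sum>(x, y)\<in>splits c. \<Sum>C\<in>cuts y.
            coeff f (?hd ((b # p) # x) # map ?hd C))"
        by (simp add: Cons coeff_comp[of _ h] coeff_comp[of f g] sum_cuts_Cons sum_cuts_map
            sum_splits_map comp_def)
      also have "\<dots> = (\<Sum>(p, q)\<in>splits r. \<Sum>(u, v)\<in>splits q. \<Sum>x\<in>cuts u. \<Sum>y\<in>cuts v. \<Sum>C\<in>cuts y.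
            coeff f (?hd ((b # p) # x) # map ?hd C))"
        by (simp only: sum_cuts_splits)
      also have "\<dots> = (\<Sum>(u, v)\<in>splits r. \<Sum>x\<in>cuts (b # u). \<Sum>y\<in>cuts v. \<Sum>C\<in>cuts y.
            coeff f (?hd x # map ?hd C))"
        by (simp add: sum_splits_assoc[symmetric] sum_cuts_Cons)
      also have "\<dots> = (\<Sum>(u, v)\<in>splits r. \<Sum>d\<in>cuts v. \<Sum>x\<in>cuts (b # u).
            coeff f (?hd x # map (coeff (g \<circ>\<^sub>s h)) d))"
        by (rule sum.cong) (auto simp: IH intro: sum.swap)
      also have "\<dots> = (\<Sum>(u, v)\<in>splits r. \<Sum>d\<in>cuts v.
            coeff f (coeff (g \<circ>\<^sub>s h) (b # u) # map (coeff (g \<circ>\<^sub>s h)) d))"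
        by (simp add: coeff_comp[of g h] lin_apply_sum[OF multilinear_Cons[OF 1(2)]])
      finally show ?thesis by (simp add: Cons coeff_comp[of f "g \<circ>\<^sub>s h"] sum_cuts_Cons)
    qed simp
  qed
qed

text \<open>
  With \<open>c\<close> the inverse of the constant term, \<open>c f\<close> has the form \<open>1 - n\<close> for some \<open>n\<close> without constant
  term, so the geometric series applies.
\<close>

lemma inverse_ex:
  assumes "multilinear f" "invertible_elem (coeff f [])"
  shows "\<exists>g. multilinear g \<and> f * g = 1 \<and> g * f = 1"
proof -
  obtain c where c: "coeff f [] * c = 1" "c * coeff f [] = 1"
    using assms(2) by (auto simp: invertible_elem_def)
  let ?a = "coeff f []"
  define n where "n = 1 - const c * f"
  define V where "V = geometric \<circ>\<^sub>s n"
  have n0: "coeff n [] = 0" by (simp add: n_def c)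
  note V = geometric_left_inverse[OF n0] geometric_right_inverse[OF n0]
  have n1: "1 - n = const c * f" by (simp add: n_def)
  have ac: "const ?a * const c = 1"
    by (rule series_eqI) (simp add: coeff_const coeff_one c)
  have "f * (V * const c) = const ?a * const c * f * (V * const c)"
    by (simp only: ac mult_1_left)
  also have "\<dots> = const ?a * ((1 - n) * V) * const c"
    by (simp only: n1 mult.assoc)
  finally have "f * (V * const c) = const ?a * ((1 - n) * V) * const c" .
  then have "f * (V * const c) = 1"
    using V by (simp add: V_def ac)
  moreover have "V * const c * f = 1"
    using V by (simp add: V_def n1[symmetric] mult.assoc)
  moreover have "multilinear (V * const c)"
    unfolding V_def n_def
    by (intro multilinear_mult multilinear_comp multilinear_geometric multilinear_diff
        multilinear_one multilinear_const assms)
  ultimately show ?thesis by blast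
qed

lemma mul_inv_eqI:
  assumes "multilinear g" "f * g = 1" "g * f = 1"
  shows "mul_inv scale (coeff f) = coeff g"
  unfolding mul_inv_def
proof (rule the_equality)
  show "coeff g \<in> Mul scale \<and> coeff f \<odot> coeff g = mul_one \<and> coeff g \<odot> coeff f = mul_one"
    using assms by (simp add: mul_eqs multilinear_iff_Mul)
next
  fix \<beta> assume \<beta>: "\<beta> \<in> Mul scale \<and> coeff f \<odot> \<beta> = mul_one \<and> \<beta> \<odot> coeff f = mul_one"
  define h where "h = Series \<beta>"
  have "coeff (h * f) = coeff 1"
    using \<beta> by (simp add: mul_eqs[symmetric] h_def)
  then have "h * f = 1" by (simp add: coeff_inject)
  have "h = h * (f * g)" by (simp only: assms mult.right_neutral)
  also have "\<dots> = g" by (simp only: \<open>h * f = 1\<close> mult.assoc[symmetric] mult.left_neutral)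
  finally have "h = g" .
  then show "\<beta> = coeff g" by (auto simp: h_def)
qed

text \<open>
  A two-sided compositional inverse is unique by associativity of composition, so exhibiting one
  determines the definite description.
\<close>

lemma mul_comp_inv_eqI:
  assumes "multilinear g" "coeff g [] = 0" "f \<circ>\<^sub>s g = var" "g \<circ>\<^sub>s f = var"
  shows "mul_comp_inv scale (coeff f) = coeff g"
  unfolding mul_comp_inv_def
proof (rule the_equality)
  show "coeff g \<in> Mul scale \<and> coeff g [] = 0 \<and> coeff f \<circledcirc> coeff g = mul_id \<and>
      coeff g \<circledcirc> coeff f = mul_id"
    using assms by (simp add: mul_eqs multilinear_iff_Mul)
next
  fix \<beta> assume \<beta>: "\<beta> \<in> Mul scale \<and> \<beta> [] = 0 \<and> coeff f \<circledcirc> \<beta> = mul_id \<and> \<beta> \<circledcirc> coeff f = mul_id"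
  define h where "h = Series \<beta>"
  have "coeff (f \<circ>\<^sub>s h) = coeff var"
    using \<beta> by (simp add: mul_eqs[symmetric] h_def)
  then have "f \<circ>\<^sub>s h = var" by (simp add: coeff_inject)
  moreover have "coeff h [] = 0" using \<beta> by (simp add: h_def)
  ultimately have "h = g"
    using assms comp_assoc[of g f h] by (simp add: var_comp comp_var)
  then show "\<beta> = coeff g" by (auto simp: h_def)
qed

end

section \<open>Compositional inverses\<close>

definition agree :: "nat \<Rightarrow> ('c, 'a) series \<Rightarrow> ('c, 'a) series \<Rightarrow> bool"
  where "agree n f g \<longleftrightarrow> (\<forall>bs. length bs < n \<longrightarrow> coeff f bs = coeff g bs)"

lemma agree_mult:
  fixes f :: "('c, 'a::ring) series"
  assumes "agree n f f'" "agree n g g'"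
  shows "agree n (f * g) (f' * g')"
  unfolding agree_def coeff_mult
proof (intro allI impI sum.cong refl, clarify)
  fix bs u v :: "'c list" assume "length bs < n" "(u, v) \<in> splits bs"
  then have "length u < n" "length v < n" by (auto dest: splits_length)
  then show "coeff f u * coeff g v = coeff f' u * coeff g' v"
    using assms by (simp add: agree_def)
qed

lemma agree_comp:
  fixes h h' :: "('b, 'c) series"
  assumes "agree n h h'"
  shows "agree n (f \<circ>\<^sub>s h) (f \<circ>\<^sub>s h')"
  unfolding agree_def
proof (intro allI impI)
  fix bs :: "'b list" assume bs: "length bs < n"
  have "coeff h x = coeff h' x" if "c \<in> cuts bs" "x \<in> set c" for c x
  proof -
    have "length x \<le> length (concat c)"
      using that(2) by (auto simp: length_concat intro: member_le_sum_list)
    then show ?thesis using that(1) assms bs by (auto simp: cuts_def agree_def)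
  qed
  then show "coeff (f \<circ>\<^sub>s h) bs = coeff (f \<circ>\<^sub>s h') bs"
    unfolding coeff_comp by (intro sum.cong refl arg_cong[where f = "coeff f"] map_cong) auto
qed

lemma agree_inverse:
  fixes f :: "('c, 'a::{ring,monoid_mult}) series"
  assumes "agree n f f'" "g * f = 1" "f' * g' = 1"
  shows "agree n g g'"
proof -
  have "agree n (g * f * g') (g * f' * g')"
    by (intro agree_mult assms) (simp_all add: agree_def)
  then show ?thesis using assms by (simp add: mult.assoc agree_def)
qed

text \<open>
  Multiplication by the variable gains one degree. This is the contraction property that lets
  fixed-point iterations converge degree by degree.
\<close>

lemma agree_var_mult: "agree n f g \<Longrightarrow> agree (Suc n) (var * f) (var * g)"
  unfolding agree_def
proof (intro allI impI)
  fix bs :: "'a list"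
  assume "\<forall>bs. length bs < n \<longrightarrow> coeff f bs = coeff g bs" "length bs < Suc n"
  then show "coeff (var * f) bs = coeff (var * g) bs" by (cases bs) auto
qed

context unital_algebra
begin

text \<open>
  A series \<open>G\<close> without constant term is a right inverse of \<open>I f\<close> iff \<open>G (f \<circ> G) = I\<close>, that is,
  \<open>G = I (f \<circ> G)\<^sup>-\<^sup>1\<close>. The right-hand side in degree \<open>n + 1\<close> depends on \<open>G\<close> only up to degree \<open>n\<close>, so
  iterating it from \<open>0\<close> converges degree by degree. The solution again has the form \<open>I u\<close> with \<open>u\<close>
  invertible.
\<close>

lemma comp_right_inverse:
  assumes f: "multilinear f" "invertible_elem (coeff f [])"
  obtains u where "multilinear u" "invertible_elem (coeff u [])"
    "(var * f) \<circ>\<^sub>s (var * u) = var"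
proof -
  have "\<exists>g. multilinear h \<longrightarrow> multilinear g \<and> (f \<circ>\<^sub>s h) * g = 1 \<and> g * (f \<circ>\<^sub>s h) = 1" for h
    using inverse_ex[of "f \<circ>\<^sub>s h"] f multilinear_comp[of f h] by auto
  then obtain J where J: "\<And>h. multilinear h \<Longrightarrow> multilinear (J h)"
      "\<And>h. multilinear h \<Longrightarrow> (f \<circ>\<^sub>s h) * J h = 1" "\<And>h. multilinear h \<Longrightarrow> J h * (f \<circ>\<^sub>s h) = 1"
    by metis
  define \<Gamma> where "\<Gamma> h = var * J h" for h
  have \<Gamma>_mul: "multilinear (\<Gamma> h)" if "multilinear h" for h
    unfolding \<Gamma>_def by (intro multilinear_mult multilinear_var J that)
  have \<Gamma>_agree: "agree (Suc n) (\<Gamma> h) (\<Gamma> h')" if "agree n h h'" "multilinear h" "multilinear h'" for n h h'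
    unfolding \<Gamma>_def
    by (rule agree_var_mult, rule agree_inverse[OF agree_comp[OF that(1)]]) (use J that in auto)
  define g where "g n = (\<Gamma> ^^ n) 0" for n
  have g_mul: "multilinear (g n)" for n
    by (induction n) (simp_all add: g_def multilinear_zero \<Gamma>_mul)
  have step: "agree n (g n) (g (Suc n))" for n
  proof (induction n)
    case (Suc n)
    then show ?case
      using \<Gamma>_agree[OF Suc g_mul g_mul] by (simp add: g_def)
  qed (simp add: agree_def)
  have stable: "agree n (g n) (g (n + k))" for n k
  proof (induction k)
    case (Suc k)
    then show ?case using step[of "n + k"] by (auto simp: agree_def)
  qed (simp add: agree_def)
  \<comment> \<open>the coefficients of length \<open>n\<close> are stable from the iterate \<open>n + 1\<close> on\<close>
  define G where "G = Series (\<lambda>bs. coeff (g (Suc (length bs))) bs)"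
  have G_agree: "agree n G (g n)" for n
    unfolding agree_def
  proof (intro allI impI)
    fix bs :: "'a list" assume "length bs < n"
    then obtain k where "n = Suc (length bs) + k" by (metis Suc_leI le_add_diff_inverse)
    then show "coeff G bs = coeff (g n) bs"
      using stable[of "Suc (length bs)" k] by (simp add: G_def agree_def)
  qed
  have G_mul: "multilinear G"
    unfolding multilinear_def
  proof (intro allI)
    fix us vs
    have "(\<lambda>b. coeff G (us @ b # vs)) =
        (\<lambda>b. coeff (g (Suc (length us + Suc (length vs)))) (us @ b # vs))"
      by (simp add: G_def)
    then show "lin (\<lambda>b. coeff G (us @ b # vs))"
      using g_mul unfolding multilinear_def by simp
  qed
  have fixpoint: "\<Gamma> G = G"
  proof (rule series_eqI)
    fix bs :: "'a list"
    let ?n = "length bs"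
    have "agree (Suc ?n) (\<Gamma> G) (g (Suc ?n))"
      using \<Gamma>_agree[OF G_agree G_mul g_mul, of ?n] by (simp add: g_def)
    then show "coeff (\<Gamma> G) bs = coeff G bs"
      using G_agree[of "Suc ?n"] by (simp add: agree_def)
  qed
  have "coeff (\<Gamma> G) [] = 0" by (simp add: \<Gamma>_def)
  then have G0: "coeff G [] = 0" by (simp only: fixpoint)
  have "(var * f) \<circ>\<^sub>s G = G * (f \<circ>\<^sub>s G)"
    by (simp add: comp_mult var_comp[OF G0])
  also have "\<dots> = \<Gamma> G * (f \<circ>\<^sub>s G)"
    by (simp only: fixpoint)
  also have "\<dots> = var" using J(3)[OF G_mul] by (simp add: \<Gamma>_def mult.assoc)
  finally have "(var * f) \<circ>\<^sub>s (var * J G) = var"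
    using fixpoint by (simp add: \<Gamma>_def)
  moreover have "invertible_elem (coeff (J G) [])"
  proof -
    have "coeff ((f \<circ>\<^sub>s G) * J G) [] = 1" "coeff (J G * (f \<circ>\<^sub>s G)) [] = 1"
      using J(2,3)[OF G_mul] by simp_all
    then show ?thesis unfolding invertible_elem_def coeff_mult_Nil by blast
  qed
  ultimately show ?thesis using that J(1)[OF G_mul] by blast
qed

text \<open>
  Series of the form \<open>I f\<close> with invertible \<open>f\<close> have right inverses of the same form, so as in any
  group a right inverse is a left inverse.
\<close>

lemma comp_right_inverse_imp_left:
  assumes f: "multilinear f" "invertible_elem (coeff f [])"
    and g: "multilinear g" "coeff g [] = 0" "(var * f) \<circ>\<^sub>s g = var"
  shows "g \<circ>\<^sub>s (var * f) = var"
proof -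
  obtain u where u: "multilinear u" "invertible_elem (coeff u [])" "(var * f) \<circ>\<^sub>s (var * u) = var"
    using comp_right_inverse[OF f] by blast
  obtain v where v: "multilinear v" "(var * u) \<circ>\<^sub>s (var * v) = var"
    using comp_right_inverse[OF u(1,2)] by blast
  have mul: "multilinear (var * f)" "multilinear (var * u)"
    by (intro multilinear_mult multilinear_var f u)+
  have "var * v = ((var * f) \<circ>\<^sub>s (var * u)) \<circ>\<^sub>s (var * v)"
    by (simp only: u(3)) (simp add: var_comp)
  also have "\<dots> = var * f"
    by (simp only: comp_assoc[OF mul(1)] v(2) comp_var[OF mul(1)])
  finally have left: "(var * u) \<circ>\<^sub>s (var * f) = var" using v(2) by simp
  have "var * u = ((var * u) \<circ>\<^sub>s (var * f)) \<circ>\<^sub>s g"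
    by (simp only: comp_assoc[OF mul(2)] g(3) comp_var[OF mul(2)])
  also have "\<dots> = g" by (simp only: left var_comp[OF g(2)])
  finally show ?thesis using left by simp
qed

end

section \<open>The factorisation\<close>

text \<open>
  The equation has the unique solution \<open>r = (1 - x h)\<^sup>-\<^sup>1 x\<close>, and this equals \<open>x (1 - h x)\<^sup>-\<^sup>1\<close>.
\<close>

lemma resolvent_swap:
  fixes x h r :: "('c, 'a::{ring,monoid_mult}) series"
  assumes "coeff h [] = 0" and r: "r = x + x * h * r"
  shows "r = x + r * h * x"
proof -
  have n0: "coeff (x * h) [] = 0" using assms by simp
  let ?V = "geometric \<circ>\<^sub>s (x * h)"
  note V = geometric_right_inverse[OF n0] geometric_left_inverse[OF n0]
  have "r - x * h * r = x" using r unfolding diff_eq_eq .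
  then have "(1 - x * h) * r = x" unfolding left_diff_distrib mult_1_left .
  then have "?V * (1 - x * h) * r = ?V * x" by (simp only: mult.assoc)
  then have rV: "r = ?V * x" by (simp only: V mult_1_left)
  have "?V - ?V * (x * h) = 1" using V(2) unfolding right_diff_distrib mult_1_right .
  then have "(?V - ?V * (x * h)) * x = x" by (simp only: mult_1_left)
  then have "?V * x - ?V * x * h * x = x" by (simp only: left_diff_distrib mult.assoc)
  then show ?thesis unfolding rV[symmetric] diff_eq_eq .
qed

text \<open>
  Here \<open>r\<^sub>x = x (1 - c x)\<^sup>-\<^sup>1\<close> and \<open>r\<^sub>y = y (1 - d y)\<^sup>-\<^sup>1\<close>, so \<open>P = 1 + c r\<^sub>x = (1 - c x)\<^sup>-\<^sup>1\<close> and
  \<open>Q = 1 + d r\<^sub>y = (1 - d y)\<^sup>-\<^sup>1\<close>, while \<open>z\<close>, \<open>z'\<close> invert \<open>1 + w\<close>, \<open>1 + w'\<close>. From \<open>P c x = P - 1\<close> and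
  \<open>y Q = r\<^sub>y\<close> one gets \<open>P (t - c x y) Q = P t Q - (P - 1) r\<^sub>y\<close>. Writing \<open>P = 1 + w' + p\<close>,
  \<open>r\<^sub>y = t (1 + w) + r\<close> and \<open>Q = 1 + w + d r\<close>, the terms in \<open>p\<close> alone drop out of themselves and those in
  \<open>r\<close> alone because \<open>(1 + w') t d = w'\<close>. The remaining terms are \<open>t (1 + w)\<close> and
  \<open>p (t d - 1) r = - p (1 + w')\<^sup>-\<^sup>1 r\<close>.
\<close>

lemma resolvent_factorisation:
  fixes x y t t' c d r\<^sub>x r\<^sub>y w w' z z' V :: "'a::{ring,monoid_mult}"
  assumes rx: "r\<^sub>x = x + r\<^sub>x * c * x" "r\<^sub>x = x + x * c * r\<^sub>x"
    and ry: "r\<^sub>y = y + y * d * r\<^sub>y"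
    and t: "t * t' = 1" "t' * t = 1"
    and z: "(1 + w) * z = 1" "z * (1 + w) = 1"
    and z': "(1 + w') * z' = 1" "z' * (1 + w') = 1"
    and w': "w' = t * w * t'"
    and d: "d * t * (1 + w) = w"
    and V: "(1 - (1 + c * r\<^sub>x - (1 + w')) * (z' * (r\<^sub>y - t * (1 + w)) * (z * t'))) * V = 1"
  shows "(1 - t' * c * x * y) * ((1 + d * r\<^sub>y) * (z * t') * V * (1 + c * r\<^sub>x) * t) = 1"
proof -
  define P where "P = 1 + c * r\<^sub>x"
  define Q where "Q = 1 + d * r\<^sub>y"
  define p where "p = P - (1 + w')"
  define r where "r = r\<^sub>y - t * (1 + w)"
  define D where "D = t - c * x * y"
  have tw: "t * w = w' * t" by (simp add: w' mult.assoc t)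
  have td: "t * d = w' * z'"
  proof -
    have "(t * d) * (1 + w') * t = t * (d * t * (1 + w))"
      by (simp add: distrib_left distrib_right mult.assoc tw)
    then have "(t * d) * (1 + w') * t * t' = w' * t * t'" by (simp only: d tw)
    then have "(t * d) * (1 + w') = w'" by (simp add: mult.assoc t)
    then have "(t * d) * (1 + w') * z' = w' * z'" by (simp only:)
    then show ?thesis by (simp add: mult.assoc z')
  qed
  have "w' * z' = (1 + w') * z' - z'" by (simp add: distrib_right)
  then have wz: "w' * z' = 1 - z'" by (simp only: z')
  have ztd: "(1 + w') * (t * d) = w'"
    unfolding td wz using z' by (simp add: right_diff_distrib)
  have PX: "P * (c * x) = P - 1"
  proof -
    have "P * (c * x) = c * (x + r\<^sub>x * c * x)" by (simp add: P_def distrib_left distrib_right mult.assoc)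
    then show ?thesis by (simp only: rx(1)[symmetric]) (simp add: P_def)
  qed
  have XP: "(1 - c * x) * P = 1"
  proof -
    have "(1 - c * x) * P = 1 + c * (r\<^sub>x - (x + x * c * r\<^sub>x))"
      by (simp add: P_def distrib_left distrib_right left_diff_distrib right_diff_distrib mult.assoc)
    then show ?thesis by (simp only: rx(2)[symmetric]) simp
  qed
  have yQ: "y * Q = r\<^sub>y"
    using ry by (simp add: Q_def distrib_left mult.assoc)
  have Q: "Q = (1 + w) + d * r"
    by (simp add: Q_def r_def right_diff_distrib mult.assoc[symmetric] d)
  have P: "P = (1 + w') + p" by (simp add: p_def)
  have R: "r\<^sub>y = t * (1 + w) + r" by (simp add: r_def)
  have "P * D * Q = P * t * Q - (P * (c * x)) * (y * Q)"
    by (simp add: D_def left_diff_distrib right_diff_distrib mult.assoc)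
  also have "\<dots> = ((1 + w') + p) * t * ((1 + w) + d * r) - (w' + p) * (t * (1 + w) + r)"
    unfolding PX yQ by (subst R, subst (1) Q, simp add: P)
  also have "\<dots> = t * (1 + w) + ((1 + w') * (t * d) - w') * r + p * (t * d - 1) * r"
    by (simp add: algebra_simps)
  also have "\<dots> = t * (1 + w) - p * z' * r"
    by (simp only: ztd) (simp add: td wz)
  also have "\<dots> = (1 - p * (z' * r * (z * t'))) * (t * (1 + w))"
  proof -
    have "z * t' * (t * (1 + w)) = z * (t' * t) * (1 + w)" by (simp only: mult.assoc)
    then have "z * t' * (t * (1 + w)) = 1" by (simp only: t mult_1_right z)
    then have "p * (z' * r * (z * t')) * (t * (1 + w)) = p * z' * r"
      by (simp add: mult.assoc)
    then show ?thesis by (simp add: left_diff_distrib)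
  qed
  finally have PDQ: "P * D * Q = (1 - p * (z' * r * (z * t'))) * (t * (1 + w))" .
  define U where "U = Q * (z * t') * V"
  have "P * D * U = (1 - p * (z' * r * (z * t'))) * (t * ((1 + w) * z) * t') * V"
    using PDQ by (simp add: U_def mult.assoc[symmetric])
  also have "\<dots> = (1 - p * (z' * r * (z * t'))) * V" by (simp only: z mult_1_right t)
  also have "\<dots> = 1"
    using V by (simp only: p_def P_def r_def)
  finally have PDU: "P * D * U = 1" .
  have "D * U * P = ((1 - c * x) * P) * D * U * P" by (simp only: XP mult_1_left)
  also have "\<dots> = (1 - c * x) * (P * D * U) * P" by (simp only: mult.assoc)
  also have "\<dots> = 1" by (simp only: PDU mult_1_right XP)
  finally have DUP: "D * U * P = 1" .
  have "1 - t' * c * x * y = t' * D"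
    by (simp add: D_def right_diff_distrib t mult.assoc)
  then have "(1 - t' * c * x * y) * (U * P * t) = t' * (D * U * P) * t"
    by (simp only: mult.assoc)
  then show ?thesis
    by (simp only: DUP mult_1_right t) (simp only: U_def P_def Q_def)
qed

section \<open>Alternating words\<close>

text \<open>
  Coefficients of products of series are sums of products, so the alternating words are closed under
  addition from the start. The index \<open>j\<close> is the family of the first letter.
\<close>

inductive alternating :: "(bool \<Rightarrow> 'a::ring set) \<Rightarrow> bool \<Rightarrow> 'a \<Rightarrow> bool" for C
  where
    letter: "a \<in> C j \<Longrightarrow> alternating C j a"
  | word: "a \<in> C j \<Longrightarrow> alternating C (\<not> j) u \<Longrightarrow> alternating C j (a * u)"
  | zero: "alternating C j 0"
  | add: "alternating C j u \<Longrightarrow> alternating C j v \<Longrightarrow> alternating C j (u + v)"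

lemma alternating_sum:
  "(\<And>i. i \<in> I \<Longrightarrow> alternating C j (f i)) \<Longrightarrow> alternating C j (\<Sum>i\<in>I. f i)"
  by (induction I rule: infinite_finite_induct) (auto intro: alternating.zero alternating.add)

definition series_in :: "'a set \<Rightarrow> ('c, 'a) series \<Rightarrow> bool"
  where "series_in S f \<longleftrightarrow> range (coeff f) \<subseteq> S"

lemma alternating_series_mult:
  assumes "series_in (C j) f" "series_in (Collect (alternating C (\<not> j))) g"
  shows "series_in (Collect (alternating C j)) (f * g)"
  using assms unfolding series_in_def
  by (auto simp: coeff_mult intro!: alternating_sum alternating.word)

lemma alternating_series_letter:
  "series_in (C j) f \<Longrightarrow> series_in (Collect (alternating C j)) f"
  unfolding series_in_def by (auto intro!: alternating.letter)

text \<open>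
  The recursion for \<open>g\<close> is well-founded because \<open>p q\<close> has no constant term: its coefficients only meet
  coefficients of \<open>g\<close> at shorter words. This replaces the infinite sum \<open>\<Sum>n. (p q)\<^sup>n h\<close>.
\<close>

lemma alternating_series_fixpoint:
  assumes p: "series_in (C j) p" and q: "series_in (C (\<not> j)) q"
    and 0: "coeff (p * q) [] = 0"
    and h: "series_in (Collect (alternating C j)) h"
    and g: "g = h + p * q * g"
  shows "series_in (Collect (alternating C j)) g"
proof -
  have "alternating C j (coeff g bs)" for bs
  proof (induction bs rule: length_induct)
    case (1 bs)
    have "alternating C j (coeff (p * q) u * coeff g v)" if "(u, v) \<in> splits bs" for u v
    proof (cases "u = []")
      case True
      then show ?thesis by (simp only: 0 mult_zero_left alternating.zero)
    next
      case False
      then have "length v < length bs"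
        using splits_length[OF that] by (metis add_less_cancel_right add_0 length_greater_0_conv)
      then have v: "alternating C j (coeff g v)" using 1 by blast
      have "coeff (p * q) u * coeff g v = (\<Sum>(k, l)\<in>splits u. coeff p k * (coeff q l * coeff g v))"
        by (simp add: coeff_mult sum_distrib_right case_prod_beta mult.assoc)
      moreover have "alternating C j (coeff p k * (coeff q l * coeff g v))" for k l
        using p q v by (intro alternating.word) (auto simp: series_in_def)
      ultimately show ?thesis by (auto intro!: alternating_sum)
    qed
    then have "alternating C j (coeff (p * q * g) bs)"
      unfolding coeff_mult[of "p * q"] by (intro alternating_sum) auto
    then have "alternating C j (coeff h bs + coeff (p * q * g) bs)"
      using h by (intro alternating.add) (auto simp: series_in_def)
    then show ?case using g by (metis coeff_add)
  qed
  then show ?thesis by (auto simp: series_in_def)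
qed

text \<open>
  The word rule multiplies on the left, and a sum inside a word is not itself a word. The induction
  therefore carries an alternating prefix \<open>as\<close> in front of \<open>u\<close>, over which sums distribute.
\<close>

lemma free_alternating_expectation:
  assumes free: "\<And>js as. list_all2 (\<lambda>j a. a \<in> C j) js as \<Longrightarrow> distinct_adj js \<Longrightarrow> as \<noteq> [] \<Longrightarrow>
      E (prod_list as) = 0"
    and E: "additive E"
    and u: "alternating C j u"
  shows "E u = (0 :: 'b::ring)"
proof -
  interpret E: additive E by (rule E)
  have "E (prod_list as * u) = 0" if "list_all2 (\<lambda>j a. a \<in> C j) js as" "distinct_adj (js @ [j])" for js as
    using u that
  proof (induction arbitrary: js as rule: alternating.induct)
    case (letter a j)
    then show ?case
      using free[of "js @ [j]" "as @ [a]"] by (simp add: list_all2_appendI)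
  next
    case (word a j u)
    then show ?case
      using word.IH[of "js @ [j]" "as @ [a]"]
      by (simp add: list_all2_appendI mult.assoc distinct_adj_append_iff)
  next
    case (zero j)
    then show ?case by (simp add: E.zero)
  next
    case (add j u v)
    then show ?case by (simp add: distrib_left E.add)
  qed
  from this[of "[]" "[]"] show ?thesis by simp
qed

definition map_series :: "('a \<Rightarrow> 'b) \<Rightarrow> ('c, 'a) series \<Rightarrow> ('c, 'b) series"
  where "map_series \<phi> f = Series (\<lambda>bs. \<phi> (coeff f bs))"

lemma coeff_map_series [simp]: "coeff (map_series \<phi> f) bs = \<phi> (coeff f bs)"
  by (simp add: map_series_def)

lemma map_series_additive:
  assumes "additive \<phi>"
  shows "map_series \<phi> (f + g) = map_series \<phi> f + map_series \<phi> g"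
    and "map_series \<phi> (f - g) = map_series \<phi> f - map_series \<phi> g"
    and "map_series \<phi> (f \<circ>\<^sub>s h) = map_series \<phi> f \<circ>\<^sub>s h"
proof -
  interpret additive \<phi> by (rule assms)
  show "map_series \<phi> (f + g) = map_series \<phi> f + map_series \<phi> g"
    "map_series \<phi> (f - g) = map_series \<phi> f - map_series \<phi> g"
    "map_series \<phi> (f \<circ>\<^sub>s h) = map_series \<phi> f \<circ>\<^sub>s h"
    by (rule series_eqI, simp add: add diff sum coeff_comp)+
qed

context unital_algebra
begin

lemma one_plus_var_inverse:
  obtains z where "multilinear z" "(1 + var) * z = 1" "z * (1 + var) = 1"
proof -
  have "invertible_elem (coeff (1 + var :: ('a, 'a) series) [])"
    by (auto simp: invertible_elem_def)
  then show ?thesis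
    using that inverse_ex[OF multilinear_add[OF multilinear_one multilinear_var]] by blast
qed

lemma T_transform_eqI:
  assumes f: "multilinear f" "invertible_elem (coeff f [])"
    and g: "multilinear g" "coeff g [] = 0" "(var * f) \<circ>\<^sub>s g = var"
    and T: "T * (1 + var) = f \<circ>\<^sub>s g"
  shows "T_transform scale (coeff f) = coeff T"
proof -
  obtain z where z: "multilinear z" "(1 + var) * z = 1" "z * (1 + var) = 1"
    by (rule one_plus_var_inverse)
  have "mul_comp_inv scale (coeff (var * f)) = coeff g"
    by (intro mul_comp_inv_eqI comp_right_inverse_imp_left f g)
  moreover have "mul_inv scale (coeff (1 + var)) = coeff z"
    by (intro mul_inv_eqI z)
  ultimately have "T_transform scale (coeff f) = coeff ((f \<circ>\<^sub>s g) * z)"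
    by (simp add: T_transform_def mul_eqs)
  also have "(f \<circ>\<^sub>s g) * z = T"
    unfolding T[symmetric] by (simp add: mult.assoc z)
  finally show ?thesis .
qed

text \<open>
  The factor \<open>u\<close> of the compositional inverse \<open>I u\<close> of \<open>I f\<close> is the inverse of \<open>f \<circ> (I u)\<close>, as one sees
  by cancelling \<open>I\<close> from \<open>I u (f \<circ> I u) = I\<close>.
\<close>

lemma T_transform_ex:
  assumes f: "multilinear f" "invertible_elem (coeff f [])"
  obtains u T where "multilinear u" "(var * f) \<circ>\<^sub>s (var * u) = var"
    "u * (f \<circ>\<^sub>s (var * u)) = 1" "(f \<circ>\<^sub>s (var * u)) * u = 1"
    "multilinear T" "invertible_elem (coeff T [])" "T * (1 + var) = f \<circ>\<^sub>s (var * u)"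
    "T_transform scale (coeff f) = coeff T"
proof -
  obtain u where u: "multilinear u" "(var * f) \<circ>\<^sub>s (var * u) = var"
    using comp_right_inverse[OF f] by blast
  let ?F = "f \<circ>\<^sub>s (var * u)"
  have vu: "multilinear (var * u)" by (intro multilinear_mult multilinear_var u)
  have F: "multilinear ?F" by (intro multilinear_comp vu f)
  have "var * (u * ?F) = var * 1"
    using u(2) by (simp add: comp_mult var_comp mult.assoc)
  then have uF: "u * ?F = 1" by (rule var_mult_left_cancel)
  obtain v where v: "?F * v = 1" "v * ?F = 1"
    using inverse_ex[OF F] f(2) by auto
  have "u = u * ?F * v" by (simp only: mult.assoc v mult_1_right)
  then have "u = v" by (simp only: uF mult_1_left)
  with v have Fu: "?F * u = 1" by simp
  obtain z where z: "multilinear z" "(1 + var) * z = 1" "z * (1 + var) = 1"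
    by (rule one_plus_var_inverse)
  have "coeff ((1 + var) * z) [] = 1" by (simp only: z) simp
  then have z0: "coeff z [] = 1" by simp
  have T: "?F * z * (1 + var) = ?F" by (simp only: mult.assoc z mult_1_right)
  show ?thesis
  proof (rule that[OF u uF Fu _ _ T])
    show "multilinear (?F * z)" by (intro multilinear_mult F z)
    show "invertible_elem (coeff (?F * z) [])" using f by (simp add: z0)
    show "T_transform scale (coeff f) = coeff (?F * z)"
      by (rule T_transform_eqI[OF f vu _ u(2) T]) simp
  qed
qed

end

section \<open>Series over a noncommutative probability space\<close>

context valued_nc_prob_space
begin

lemma additive_embed: "additive \<iota>"
  using embed_linear by unfold_locales (simp add: Vector_Spaces.linear_iff)

lemma additive_E: "additive E"
  using E_linear by unfold_locales (simp add: Vector_Spaces.linear_iff)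

lemma E_left: "E (\<iota> b * a) = b * E a"
  using E_bimodule[of b a 1] by (simp add: embed_one)

lemma E_right: "E (a * \<iota> b) = E a * b"
  using E_bimodule[of 1 a b] by (simp add: embed_one)

abbreviation embed_series :: "('b, 'b) series \<Rightarrow> ('b, 'a) series" ("\<L>")
  where "\<L> \<equiv> map_series \<iota>"

abbreviation E_series :: "('b, 'a) series \<Rightarrow> ('b, 'b) series" ("\<E>")
  where "\<E> \<equiv> map_series E"

lemmas embed_series_additive = map_series_additive[OF additive_embed]
lemmas E_series_additive = map_series_additive[OF additive_E]

lemma embed_series_mult: "\<L> (f * g) = \<L> f * \<L> g"
proof -
  interpret additive \<iota> by (rule additive_embed)
  show ?thesis by (rule series_eqI) (simp add: coeff_mult sum embed_mult case_prod_beta)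
qed

lemma embed_series_one: "\<L> 1 = 1"
proof -
  interpret additive \<iota> by (rule additive_embed)
  show ?thesis by (rule series_eqI) (simp add: coeff_one embed_one zero)
qed

lemma E_embed_series: "\<E> (\<L> f) = f"
  by (rule series_eqI) (simp add: E_embed)

lemma E_series_left: "\<E> (\<L> f * g) = f * \<E> g"
proof -
  interpret additive E by (rule additive_E)
  show ?thesis by (rule series_eqI) (simp add: coeff_mult sum E_left case_prod_beta)
qed

lemma E_series_right: "\<E> (g * \<L> f) = \<E> g * f"
proof -
  interpret additive E by (rule additive_E)
  show ?thesis by (rule series_eqI) (simp add: coeff_mult sum E_right case_prod_beta)
qed

text \<open>The series \<open>b \<mapsto> a (1 - b a)\<^sup>-\<^sup>1\<close>.\<close>

definition resolvent :: "'a \<Rightarrow> ('b, 'a) series"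
  where "resolvent a = Series (\<lambda>bs. a * prod_list (map (\<lambda>b. \<iota> b * a) bs))"

lemma distr_series_eq: "distr_series \<iota> E a = coeff (\<E> (resolvent a))"
  by (simp add: fun_eq_iff distr_series_def resolvent_def)

lemma resolvent_unfold: "resolvent a = const a + const a * \<L> var * resolvent a"
proof (rule series_eqI)
  fix bs
  interpret additive \<iota> by (rule additive_embed)
  show "coeff (resolvent a) bs = coeff (const a + const a * \<L> var * resolvent a) bs"
  proof (cases bs)
    case Nil
    then show ?thesis by (simp add: resolvent_def coeff_const zero)
  next
    case (Cons b r)
    have "coeff (\<L> var * resolvent a) (b # r) = \<iota> b * coeff (resolvent a) r"
      unfolding coeff_mult
      by (subst sum_splits_single[of "[b]" r])
        (auto simp: var_def mul_id_def append_eq_Cons_conv zero split: list.split)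
    then show ?thesis
      by (simp add: Cons mult.assoc coeff_const) (simp add: resolvent_def mult.assoc)
  qed
qed

lemma resolvent_comp:
  assumes "coeff h [] = 0"
  shows "resolvent a \<circ>\<^sub>s h = const a + const a * \<L> h * (resolvent a \<circ>\<^sub>s h)"
    and "resolvent a \<circ>\<^sub>s h = const a + (resolvent a \<circ>\<^sub>s h) * \<L> h * const a"
proof -
  interpret additive \<iota> by (rule additive_embed)
  show eq: "resolvent a \<circ>\<^sub>s h = const a + const a * \<L> h * (resolvent a \<circ>\<^sub>s h)"
    by (subst resolvent_unfold)
      (simp add: comp_add comp_mult embed_series_additive(3)[symmetric] var_comp[OF assms])
  show "resolvent a \<circ>\<^sub>s h = const a + (resolvent a \<circ>\<^sub>s h) * \<L> h * const a"
    by (rule resolvent_swap[OF _ eq]) (simp add: assms zero)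
qed

lemma multilinear_distr: "B.multilinear (\<E> (resolvent a))"
  unfolding B.multilinear_def B.lin_def
  using E_linear embed_linear
  by (simp add: resolvent_def Vector_Spaces.linear_iff distrib_left distrib_right
      A.scale_mult_left A.mult_scale_right)

lemma coeff_distr_Nil: "coeff (\<E> (resolvent a)) [] = E a"
  by (simp add: resolvent_def)

lemma series_in_subalgebra:
  assumes S: "subalgebra scaleA S" "range \<iota> \<subseteq> S"
  shows "series_in S f \<Longrightarrow> series_in S g \<Longrightarrow> series_in S (f * g)"
    and "series_in S f \<Longrightarrow> series_in S g \<Longrightarrow> series_in S (f + g)"
    and "series_in S f \<Longrightarrow> series_in S g \<Longrightarrow> series_in S (f - g)"
    and "series_in S (\<L> h)" and "series_in S 1"
    and "a \<in> S \<Longrightarrow> series_in S (resolvent a \<circ>\<^sub>s h)"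
proof -
  have sub: "A.subspace S" and one: "1 \<in> S" and mult: "\<And>a b. a \<in> S \<Longrightarrow> b \<in> S \<Longrightarrow> a * b \<in> S"
    using S(1) by (auto simp: subalgebra_def)
  have emb: "\<iota> b \<in> S" for b using S(2) by auto
  show "series_in S f \<Longrightarrow> series_in S g \<Longrightarrow> series_in S (f * g)"
    by (auto simp: series_in_def coeff_mult intro!: mult A.subspace_sum[OF sub])
  show "series_in S f \<Longrightarrow> series_in S g \<Longrightarrow> series_in S (f + g)"
    by (auto simp: series_in_def intro!: A.subspace_add[OF sub])
  show "series_in S f \<Longrightarrow> series_in S g \<Longrightarrow> series_in S (f - g)"
    by (auto simp: series_in_def intro!: A.subspace_diff[OF sub])
  show "series_in S (\<L> h)" by (auto simp: series_in_def emb)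
  show "series_in S 1"
    by (auto simp: series_in_def coeff_one one A.subspace_0[OF sub])
  assume a: "a \<in> S"
  have "prod_list (map (\<lambda>b. \<iota> b * a) bs) \<in> S" for bs
    by (induction bs) (auto intro!: one mult emb a)
  then show "series_in S (resolvent a \<circ>\<^sub>s h)"
    by (auto simp: series_in_def coeff_comp resolvent_def simp del: map_map intro!: A.subspace_sum[OF sub] mult a)
qed

end

section \<open>Freeness and the product of resolvents\<close>

lemma invertible_elem_mult:
  assumes "invertible_elem a" "invertible_elem b"
  shows "invertible_elem (a * b)"
proof -
  obtain a' b' where ab: "a * a' = 1" "a' * a = 1" "b * b' = 1" "b' * b = 1"
    using assms by (auto simp: invertible_elem_def)
  have "a * b * (b' * a') = a * (b * b') * a'" "b' * a' * (a * b) = b' * (a' * a) * b"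
    by (simp_all only: mult.assoc)
  then show ?thesis
    unfolding invertible_elem_def by (intro exI[of _ "b' * a'"]) (simp add: ab)
qed

context valued_nc_prob_space
begin

definition centred :: "('j \<Rightarrow> 'a set) \<Rightarrow> 'j \<Rightarrow> 'a set"
  where "centred S j = {a \<in> S j. E a = 0}"

lemma series_in_centred: "series_in (centred S j) f \<longleftrightarrow> series_in (S j) f \<and> \<E> f = 0"
  by (auto simp: series_in_def centred_def coeff_inject[symmetric] fun_eq_iff)

lemma alternating_E:
  assumes free: "free_subalgebras scaleA \<iota> E UNIV S" and u: "alternating (centred S) j u"
  shows "E u = 0"
proof (rule free_alternating_expectation[OF _ additive_E u])
  fix js as
  assume "list_all2 (\<lambda>j a. a \<in> centred S j) js as" "distinct_adj js" "as \<noteq> []"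
  moreover have "E (prod_list as) = 0"
    if "length js = length as" "as \<noteq> []" "\<forall>m<length as. as ! m \<in> S (js ! m) \<and> E (as ! m) = 0"
      "\<forall>m. Suc m < length as \<longrightarrow> js ! m \<noteq> js ! Suc m"
    using free that unfolding free_subalgebras_def by blast
  ultimately show "E (prod_list as) = 0"
    by (simp add: list_all2_conv_all_nth distinct_adj_conv_nth centred_def)
qed

lemma alternating_E_series:
  assumes "free_subalgebras scaleA \<iota> E UNIV S" "series_in (Collect (alternating (centred S) j)) f"
  shows "\<E> f = 0"
  using assms by (intro series_eqI) (auto simp: series_in_def intro!: alternating_E)

text \<open>
  Needed for \<open>I \<Phi>\<^sub>x\<^sub>y\<close> to have a compositional inverse at all: \<open>E (x y)\<close> must be invertible.
\<close>

lemma E_mult_free: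
  assumes free: "free_subalgebras scaleA \<iota> E (UNIV :: bool set) S" and x: "x \<in> S True" and y: "y \<in> S False"
  shows "E (x * y) = E x * E y"
proof -
  interpret E: additive E by (rule additive_E)
  have "a - \<iota> (E a) \<in> centred S j" if "a \<in> S j" for a j
  proof -
    have "A.subspace (S j)" "range \<iota> \<subseteq> S j"
      using free by (auto simp: free_subalgebras_def subalgebra_def)
    then show ?thesis using that by (auto simp: centred_def E.diff E_embed intro!: A.subspace_diff)
  qed
  then have "alternating (centred S) True ((x - \<iota> (E x)) * (y - \<iota> (E y)))"
    using x y by (intro alternating.word alternating.letter) auto
  then have "E ((x - \<iota> (E x)) * (y - \<iota> (E y))) = 0"
    by (rule alternating_E[OF free])
  then show ?thesis
    by (simp add: left_diff_distrib right_diff_distrib E.diff E_left E_right E_embed)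
qed

text \<open>
  The hypotheses say \<open>E ((1 - c x)\<^sup>-\<^sup>1) = 1 + w'\<close>, \<open>E ((1 - d y)\<^sup>-\<^sup>1) = 1 + w\<close> and that \<open>t (1 + w)\<close> is the
  expectation of \<open>y (1 - d y)\<^sup>-\<^sup>1\<close>; the conclusion is \<open>E ((1 - b x y)\<^sup>-\<^sup>1) = 1 + w\<close> for
  \<open>b = t\<^sup>-\<^sup>1 c\<close>. The inverse of \<open>1 - b x y\<close> is
  \<open>M = Q s V P t\<close> with \<open>s = (1 + w)\<^sup>-\<^sup>1 t\<^sup>-\<^sup>1\<close> and \<open>V = (1 - p (1 + w')\<^sup>-\<^sup>1 r s)\<^sup>-\<^sup>1\<close>. Here \<open>p\<close> is centred over
  \<open>x\<close>, while \<open>r\<close>, and with it \<open>Q - (1 + w) = d r\<close>, is centred over \<open>y\<close>, also after multiplication by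
  series over \<open>B\<close>. Both \<open>V - 1\<close> and \<open>V p\<close> consist of words that begin with \<open>p\<close>, so they stay
  alternating when \<open>d r s\<close> is put in front.
\<close>

lemma free_product_resolvent:
  fixes c d t t' w' :: "('b, 'b) series"
  assumes free: "free_subalgebras scaleA \<iota> E UNIV S" and x: "x \<in> S True" and y: "y \<in> S False"
    and c0: "coeff c [] = 0" and d0: "coeff d [] = 0"
    and t: "t * t' = 1" "t' * t = 1" and w': "w' = t * var * t'"
    and Ex: "c * \<E> (resolvent x \<circ>\<^sub>s c) = w'"
    and Ey: "\<E> (resolvent y \<circ>\<^sub>s d) = t * (1 + var)"
    and d: "d * \<E> (resolvent y \<circ>\<^sub>s d) = var"
  shows "t' * c * \<E> (resolvent (x * y) \<circ>\<^sub>s (t' * c)) = var"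
proof -
  have S: "subalgebra scaleA (S j)" "range \<iota> \<subseteq> S j" for j
    using free by (auto simp: free_subalgebras_def)
  note S_intros = series_in_subalgebra[OF S]
  note L = embed_series_additive(1,2) embed_series_mult embed_series_one
  note E = E_series_additive(1,2) E_series_left E_series_right E_embed_series
  interpret embed: additive \<iota> by (rule additive_embed)
  define z z' where "z = geometric \<circ>\<^sub>s (- var :: ('b, 'b) series)" and "z' = geometric \<circ>\<^sub>s (- w')"
  have z: "(1 + var) * z = 1" "z * (1 + var) = 1"
    using geometric_right_inverse[of "- var :: ('b, 'b) series"]
      geometric_left_inverse[of "- var :: ('b, 'b) series"] by (simp_all add: z_def)
  have z': "(1 + w') * z' = 1" "z' * (1 + w') = 1"
    using geometric_right_inverse[of "- w'"] geometric_left_inverse[of "- w'"]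
    by (simp_all add: z'_def w')
  define X Y where "X = resolvent x \<circ>\<^sub>s c" and "Y = resolvent y \<circ>\<^sub>s d"
  define P where "P = 1 + \<L> c * X"
  define p where "p = P - (1 + \<L> w')"
  define r where "r = Y - \<L> t * (1 + \<L> var)"
  define s where "s = \<L> z * \<L> t'"
  define r' where "r' = \<L> z' * r * s"
  define V where "V = geometric \<circ>\<^sub>s (p * r')"
  define M where "M = (1 + \<L> d * Y) * s * V * P * \<L> t"
  have p_cent: "series_in (centred S True) p"
    unfolding series_in_centred p_def P_def
  proof
    show "series_in (S True) (1 + \<L> c * X - (1 + \<L> w'))"
      unfolding X_def by (intro S_intros x)
    show "\<E> (1 + \<L> c * X - (1 + \<L> w')) = 0"
      using Ex E_embed_series[of 1] by (simp add: E L X_def)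
  qed
  have r_cent: "series_in (centred S False) (\<L> f * r * \<L> g)" for f g
    unfolding series_in_centred
  proof
    show "series_in (S False) (\<L> f * r * \<L> g)"
      unfolding r_def Y_def by (intro S_intros y)
    have "\<L> t * (1 + \<L> var) = \<L> (t * (1 + var))" by (simp add: L)
    then have "\<E> r = 0" using Ey by (simp only: r_def E Y_def) simp
    then show "\<E> (\<L> f * r * \<L> g) = 0" by (simp add: E)
  qed
  have r'_cent: "series_in (centred S False) r'"
    using r_cent[of z' "z * t'"] by (simp add: r'_def s_def L mult.assoc)
  have p0: "coeff p [] = 0"
    using c0 by (simp add: p_def P_def w' embed.zero)
  then have k0: "coeff (p * r') [] = 0" by simp
  note VV = geometric_right_inverse[OF k0, folded V_def] geometric_left_inverse[OF k0, folded V_def]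
  have V: "V = 1 + p * r' * V"
    using VV(1) unfolding left_diff_distrib mult_1_left diff_eq_eq .
  have M: "(1 - \<L> (t' * c) * const (x * y)) * M = 1"
  proof -
    have "const (x * y) = const x * (const y :: ('b, 'a) series)"
      by (rule series_eqI) (simp add: coeff_const)
    moreover have "(1 - \<L> t' * \<L> c * const x * const y) *
        ((1 + \<L> d * Y) * (\<L> z * \<L> t') * V * (1 + \<L> c * X) * \<L> t) = 1"
    proof (rule resolvent_factorisation[where w = "\<L> var" and w' = "\<L> w'" and z' = "\<L> z'"])
      show "X = const x + X * \<L> c * const x" "X = const x + const x * \<L> c * X"
        unfolding X_def by (rule resolvent_comp[OF c0])+
      show "Y = const y + const y * \<L> d * Y"
        unfolding Y_def by (rule resolvent_comp[OF d0])
      show "\<L> t * \<L> t' = 1" "\<L> t' * \<L> t = 1" "(1 + \<L> var) * \<L> z = 1" "\<L> z * (1 + \<L> var) = 1"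
        "(1 + \<L> w') * \<L> z' = 1" "\<L> z' * (1 + \<L> w') = 1"
        using t z z' by (simp_all flip: L)
      show "\<L> w' = \<L> t * \<L> var * \<L> t'" by (simp add: w' L)
      have "d * t * (1 + var) = var" using d by (simp add: Ey mult.assoc)
      then show "\<L> d * \<L> t * (1 + \<L> var) = \<L> var" by (simp flip: L)
      show "(1 - (1 + \<L> c * X - (1 + \<L> w')) * (\<L> z' * (Y - \<L> t * (1 + \<L> var)) * (\<L> z * \<L> t'))) * V = 1"
        using VV(1) by (simp only: p_def P_def r'_def r_def s_def)
    qed
    ultimately show ?thesis
      by (simp only: M_def P_def s_def L mult.assoc)
  qed
  define b where "b = t' * c"
  have b0: "coeff b [] = 0" using c0 by (simp add: b_def)
  define R where "R = resolvent (x * y) \<circ>\<^sub>s b"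
  have R: "R = const (x * y) + R * \<L> b * const (x * y)"
    unfolding R_def by (rule resolvent_comp(2)[OF b0])
  define N where "N = 1 + \<L> b * R"
  have "N * (1 - \<L> b * const (x * y)) = 1 + \<L> b * (R - (const (x * y) + R * \<L> b * const (x * y)))"
    by (simp add: N_def algebra_simps)
  then have N: "N * (1 - \<L> b * const (x * y)) = 1" by (simp only: R[symmetric]) simp
  have "N = N * (1 - \<L> b * const (x * y)) * M"
    using M by (simp only: b_def mult.assoc mult_1_right)
  then have NM: "N = M" by (simp only: N mult_1_left)
  \<comment> \<open>expand \<open>M\<close> into \<open>(1 + w) s (1 + w') t\<close> and terms whose middle factor has expectation \<open>0\<close>\<close>
  have "series_in (centred S (\<not> True)) r'" using r'_cent by simp
  note fixpoint = alternating_series_fixpoint[where C = "centred S" and j = True, OF p_cent this k0]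
  define W where "W = V - 1"
  have VW: "V = 1 + W" by (simp add: W_def)
  have "W = p * r' * V" unfolding W_def diff_eq_eq by (subst add.commute) (rule V)
  then have "W = p * r' + p * r' * W" by (simp only: VW distrib_left mult_1_right)
  moreover have "series_in (Collect (alternating (centred S) True)) (p * r')"
    using p_cent r'_cent by (intro alternating_series_mult alternating_series_letter) auto
  ultimately have W_alt: "series_in (Collect (alternating (centred S) True)) W"
    using fixpoint by blast
  have "V * p = (1 + p * r' * V) * p" by (simp only: V[symmetric])
  then have "V * p = p + p * r' * (V * p)" by (simp add: distrib_right mult.assoc)
  then have Vp_alt: "series_in (Collect (alternating (centred S) True)) (V * p)"
    using fixpoint alternating_series_letter[where C = "centred S", OF p_cent] by blast
  define q where "q = \<L> d * r * s"
  have q_cent: "series_in (centred S False) q"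
    using r_cent[of d "z * t'"] by (simp add: q_def s_def L mult.assoc)
  note zero = alternating_E_series[OF free]
  have "\<E> W = 0" "\<E> (V * p) = 0" "\<E> q = 0" "\<E> (q * W) = 0" "\<E> (q * (V * p)) = 0"
  proof -
    show "\<E> W = 0" by (rule zero[OF W_alt])
    show "\<E> (V * p) = 0" by (rule zero[OF Vp_alt])
    show "\<E> q = 0" using q_cent by (simp add: series_in_centred)
    have "series_in (Collect (alternating (centred S) False)) (q * f)"
      if "series_in (Collect (alternating (centred S) True)) f" for f
      by (rule alternating_series_mult[where C = "centred S", OF q_cent]) (simp add: that)
    then show "\<E> (q * W) = 0" "\<E> (q * (V * p)) = 0"
      using zero W_alt Vp_alt by blast+
  qed
  note vanish = this
  have "1 + \<L> d * Y = (1 + \<L> var) + \<L> d * r"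
  proof -
    have "\<L> d * r = \<L> d * Y - \<L> (d * (t * (1 + var)))"
      by (simp add: r_def right_diff_distrib L)
    then show ?thesis using d by (simp add: Ey)
  qed
  then have "M = (\<L> (1 + var) * s + q) * V * (\<L> (1 + w') + p) * \<L> t"
    by (simp add: M_def q_def distrib_right L) (simp add: p_def)
  also have "\<dots> = (\<L> ((1 + var) * (z * t')) + q) * (V * \<L> (1 + w') + V * p) * \<L> t"
    by (simp add: s_def L(3) distrib_left mult.assoc)
  also have "V * \<L> (1 + w') = \<L> (1 + w') + W * \<L> (1 + w')"
    by (simp add: VW distrib_right)
  also have "(\<L> ((1 + var) * (z * t')) + q) * (\<L> (1 + w') + W * \<L> (1 + w') + V * p) * \<L> t =
      \<L> ((1 + var) * (z * t')) * \<L> ((1 + w') * t) + \<L> ((1 + var) * (z * t')) * W * \<L> ((1 + w') * t) +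
      \<L> ((1 + var) * (z * t')) * (V * p) * \<L> t +
      q * \<L> ((1 + w') * t) + q * W * \<L> ((1 + w') * t) + q * (V * p) * \<L> t"
    unfolding L(3)[of "1 + w'" t] by (simp add: algebra_simps)
  finally have "\<E> M = (1 + var) * (z * t') * ((1 + w') * t)"
    by (simp only: E vanish mult_zero_left mult_zero_right add_0_right)
  also have "\<dots> = ((1 + var) * z) * (t' * (1 + w') * t)"
    by (simp only: mult.assoc)
  also have "\<dots> = t' * t + (t' * t) * var * (t' * t)"
    by (simp only: z(1) mult_1_left) (simp add: w' distrib_left distrib_right mult.assoc)
  also have "\<dots> = 1 + var" by (simp only: t mult_1_left mult_1_right)
  finally have "\<E> N = 1 + var" by (simp only: NM)
  moreover have "\<E> N = 1 + b * \<E> R"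
    using E_embed_series[of 1] by (simp add: N_def E L(4))
  ultimately show ?thesis by (simp add: b_def R_def)
qed

text \<open>
  The candidate \<open>t\<^sup>-\<^sup>1 (b\<^sub>x \<circ> w')\<close> for the compositional inverse of \<open>I \<Phi>\<^sub>x\<^sub>y\<close> is what the asserted formula
  predicts: \<open>b\<^sub>a = w (1 + w)\<^sup>-\<^sup>1 T\<^sub>a\<^sup>-\<^sup>1\<close> for \<open>a = x, y, x y\<close>, and \<open>w (1 + w)\<^sup>-\<^sup>1 t\<^sup>-\<^sup>1 = t\<^sup>-\<^sup>1 w' (1 + w')\<^sup>-\<^sup>1\<close>.
\<close>

theorem T_transform_free_product:
  assumes free: "free_variables scaleA \<iota> E (UNIV :: bool set) (\<lambda>j. if j then x else y)"
    and inv: "invertible_elem (E x)" "invertible_elem (E y)"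
  shows "T_transform scaleB (distr_series \<iota> E (x * y)) =
    (T_transform scaleB (distr_series \<iota> E x) \<circledcirc>
      (T_transform scaleB (distr_series \<iota> E y) \<odot> mul_id \<odot>
        mul_inv scaleB (T_transform scaleB (distr_series \<iota> E y)))) \<odot>
    T_transform scaleB (distr_series \<iota> E y)"
proof -
  let ?S = "\<lambda>j. subalgebra scaleA hull (insert (if j then x else y) (range \<iota>))"
  let ?\<Phi> = "\<lambda>a. \<E> (resolvent a)"
  have S: "free_subalgebras scaleA \<iota> E UNIV ?S"
    using free unfolding free_variables_def .
  have xS: "x \<in> ?S True" and yS: "y \<in> ?S False"
    by (simp_all add: hull_inc)
  have inv\<Phi>: "invertible_elem (coeff (?\<Phi> x) [])" "invertible_elem (coeff (?\<Phi> y) [])"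
    using inv by (simp_all only: coeff_distr_Nil)
  have inv_xy: "invertible_elem (coeff (?\<Phi> (x * y)) [])"
    using invertible_elem_mult[OF inv] by (simp only: coeff_distr_Nil E_mult_free[OF S xS yS])
  obtain u\<^sub>x T\<^sub>x where x:
    "B.multilinear u\<^sub>x" "(var * ?\<Phi> x) \<circ>\<^sub>s (var * u\<^sub>x) = var"
    "u\<^sub>x * (?\<Phi> x \<circ>\<^sub>s (var * u\<^sub>x)) = 1" "(?\<Phi> x \<circ>\<^sub>s (var * u\<^sub>x)) * u\<^sub>x = 1"
    "B.multilinear T\<^sub>x" "T\<^sub>x * (1 + var) = ?\<Phi> x \<circ>\<^sub>s (var * u\<^sub>x)"
    "T_transform scaleB (coeff (?\<Phi> x)) = coeff T\<^sub>x"
    by (rule B.T_transform_ex[OF multilinear_distr inv\<Phi>(1)])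
  obtain u\<^sub>y t where y:
    "B.multilinear u\<^sub>y" "(var * ?\<Phi> y) \<circ>\<^sub>s (var * u\<^sub>y) = var"
    "B.multilinear t" "invertible_elem (coeff t [])" "t * (1 + var) = ?\<Phi> y \<circ>\<^sub>s (var * u\<^sub>y)"
    "T_transform scaleB (coeff (?\<Phi> y)) = coeff t"
    by (rule B.T_transform_ex[OF multilinear_distr inv\<Phi>(2)])
  obtain t' where t': "B.multilinear t'" "t * t' = 1" "t' * t = 1"
    using B.inverse_ex[OF y(3,4)] by blast
  define w' where "w' = t * var * t'"
  define c where "c = (var * u\<^sub>x) \<circ>\<^sub>s w'"
  have w'0: "coeff w' [] = 0" by (simp add: w'_def)
  have ml: "B.multilinear (var * u\<^sub>x)" "B.multilinear (var * ?\<Phi> x)" "B.multilinear w'" "B.multilinear c"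
    unfolding c_def w'_def
    by (intro B.multilinear_mult B.multilinear_comp B.multilinear_var multilinear_distr x y t')+
  have c0: "coeff c [] = 0" by (simp add: c_def)
  have c: "c = w' * (u\<^sub>x \<circ>\<^sub>s w')" by (simp add: c_def comp_mult var_comp[OF w'0])
  have \<Phi>xc: "?\<Phi> x \<circ>\<^sub>s c = (?\<Phi> x \<circ>\<^sub>s (var * u\<^sub>x)) \<circ>\<^sub>s w'"
    unfolding c_def by (rule B.comp_assoc[OF multilinear_distr, symmetric])
  have ex: "c * (?\<Phi> x \<circ>\<^sub>s c) = w'"
  proof -
    have "c * (?\<Phi> x \<circ>\<^sub>s c) = ((var * u\<^sub>x) * (?\<Phi> x \<circ>\<^sub>s (var * u\<^sub>x))) \<circ>\<^sub>s w'"
      unfolding \<Phi>xc by (simp add: c_def comp_mult)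
    also have "\<dots> = w'" by (simp add: mult.assoc x(3) var_comp[OF w'0])
    finally show ?thesis .
  qed
  define u where "u = t' * (u\<^sub>x \<circ>\<^sub>s w')"
  have b: "t' * c = var * u"
    unfolding c w'_def u_def by (simp only: mult.assoc[symmetric] t' mult_1_left)
  have ml_b: "B.multilinear (var * u)"
    unfolding b[symmetric] by (intro B.multilinear_mult t' ml)
  have "t' * c * \<E> (resolvent (x * y) \<circ>\<^sub>s (t' * c)) = var"
  proof (rule free_product_resolvent[OF S xS yS c0 _ t'(2,3) w'_def])
    show "coeff (var * u\<^sub>y) [] = 0" by simp
    show "c * \<E> (resolvent x \<circ>\<^sub>s c) = w'" by (simp add: E_series_additive ex)
    show "\<E> (resolvent y \<circ>\<^sub>s (var * u\<^sub>y)) = t * (1 + var)" by (simp only: E_series_additive y)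
    show "var * u\<^sub>y * \<E> (resolvent y \<circ>\<^sub>s (var * u\<^sub>y)) = var"
      using y(2) by (simp add: E_series_additive comp_mult var_comp)
  qed
  then have main: "var * u * (?\<Phi> (x * y) \<circ>\<^sub>s (var * u)) = var"
    by (simp only: b E_series_additive)
  then have inv_b: "(var * ?\<Phi> (x * y)) \<circ>\<^sub>s (var * u) = var"
    by (simp add: comp_mult var_comp)
  have "var * (u * (?\<Phi> (x * y) \<circ>\<^sub>s (var * u))) = var * 1"
    using main by (simp add: mult.assoc)
  then have u\<Phi>: "u * (?\<Phi> (x * y) \<circ>\<^sub>s (var * u)) = 1" by (rule var_mult_left_cancel)
  define T where "T = (T\<^sub>x \<circ>\<^sub>s w') * t"
  have "t * (1 + var) = (1 + w') * t"
    by (simp add: w'_def distrib_left distrib_right mult.assoc t')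
  then have "T * (1 + var) = ((T\<^sub>x * (1 + var)) \<circ>\<^sub>s w') * t"
    by (simp add: T_def comp_mult comp_add var_comp[OF w'0] mult.assoc)
  then have T: "T * (1 + var) = ((?\<Phi> x \<circ>\<^sub>s (var * u\<^sub>x)) \<circ>\<^sub>s w') * t" by (simp only: x(6))
  have "T * (1 + var) * u = (((?\<Phi> x \<circ>\<^sub>s (var * u\<^sub>x)) * u\<^sub>x) \<circ>\<^sub>s w')"
    unfolding T u_def comp_mult by (simp add: mult.assoc t' flip: mult.assoc[of t])
  then have Tu: "T * (1 + var) * u = 1" by (simp only: x(4) comp_one)
  have "T * (1 + var) = T * (1 + var) * (u * (?\<Phi> (x * y) \<circ>\<^sub>s (var * u)))"
    by (simp only: u\<Phi> mult_1_right)
  also have "\<dots> = (T * (1 + var) * u) * (?\<Phi> (x * y) \<circ>\<^sub>s (var * u))"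
    by (simp only: mult.assoc)
  finally have "T * (1 + var) = ?\<Phi> (x * y) \<circ>\<^sub>s (var * u)" by (simp only: Tu mult_1_left)
  from B.T_transform_eqI[OF multilinear_distr inv_xy ml_b _ inv_b this]
  have Txy: "T_transform scaleB (coeff (?\<Phi> (x * y))) = coeff T" by simp
  have "mul_inv scaleB (coeff t) = coeff t'" by (rule B.mul_inv_eqI[OF t'])
  then show ?thesis
    by (simp add: distr_series_eq Txy x(7) y(6) mul_eqs T_def w'_def)
qed

end

theorem theorem7p18:
  fixes scaleB :: "'k::field \<Rightarrow> 'b::{ring,monoid_mult} \<Rightarrow> 'b"
    and scaleA :: "'k \<Rightarrow> 'a::{ring,monoid_mult} \<Rightarrow> 'a"
    and \<iota> :: "'b \<Rightarrow> 'a" and E :: "'a \<Rightarrow> 'b" and x y :: 'a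
  assumes "valued_nc_prob_space scaleB scaleA \<iota> E"
    and "free_variables scaleA \<iota> E (UNIV :: bool set) (\<lambda>j. if j then x else y)"
    and "invertible_elem (E x)" and "invertible_elem (E y)"
  shows "T_transform scaleB (distr_series \<iota> E (x * y)) =
    (T_transform scaleB (distr_series \<iota> E x) \<circledcirc>
      (T_transform scaleB (distr_series \<iota> E y) \<odot> mul_id \<odot>
        mul_inv scaleB (T_transform scaleB (distr_series \<iota> E y)))) \<odot>
    T_transform scaleB (distr_series \<iota> E y)"
  using valued_nc_prob_space.T_transform_free_product[OF assms] .

end
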